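(* For every $\epsilon>0$ there is $q_0(\epsilon)$ such that for every odd prime power $q\geqslant q_0(\epsilon)$ and every subset $Y\subseteq \mathbb{F}_q$ with $|Y|\leqslant (\tfrac12-\epsilon)\log_2 q$, the set $\mathcal{S}_q$ shatters $Y$. Equivalently, $\liminf_{q\to\infty} \frac{m_q}{\log_2 q}\geqslant \frac12$, where $m_q$ is the largest integer such that every subset $Y\subseteq\mathbb{F}_q$ with $|Y|\leqslant m_q$ is shattered by $\mathcal{S}_q$.
   Context: Let $q$ be an odd prime power and $\mathcal{S}_q=\{x^2 : x\in\mathbb{F}_q^\times\}$ the set of nonzero squares in $\mathbb{F}_q$. For $x\in\mathbb{F}_q$ write $\mathcal{S}_q+x=\{z+x: z\in\mathcal{S}_q\}$. A set $Y=\{y_1,\dots,y_n\}\subseteq\mathbb{F}_q$ (with $n$ distinct elements) is shattered by $\mathcal{S}_q$ if for every subset $A\subseteq Y$ (including $\emptyset$ and $Y$) there exists $x\in\mathbb{F}_q$ with $x\notin Y$ such that for all $j$, $y_j\in A$ if and only if $y_j\in \mathcal{S}_q+x$. The limit inferior is taken over odd prime powers $q\to\infty$. *)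

theory Defs
  imports "HOL-Algebra.AbelCoset" "HOL-Number_Theory.Prime_Powers" "HOL-Library.Extended_Real"
begin

definition nonzero_squares :: "('a, 'm) ring_scheme \<Rightarrow> 'a set" where
  "nonzero_squares K = {x [^]\<^bsub>K\<^esub> (2::nat) | x. x \<in> carrier K - {\<zero>\<^bsub>K\<^esub>}}"

text \<open>\<open>S +>\<^bsub>K\<^esub> x\<close> is the translate of \<open>S\<close> by \<open>x\<close>; \<open>S\<close> need not be a subgroup.\<close>

definition shatters :: "('a, 'm) ring_scheme \<Rightarrow> 'a set \<Rightarrow> 'a set \<Rightarrow> bool" where
  "shatters K S Y \<longleftrightarrow>
     (\<forall>A\<subseteq>Y. \<exists>x\<in>carrier K. x \<notin> Y \<and> (\<forall>y\<in>Y. y \<in> A \<longleftrightarrow> y \<in> S +>\<^bsub>K\<^esub> x))"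

text \<open>For a finite field the maximum exists: \<open>m = 0\<close> qualifies, since the empty set is shattered,
  and no \<open>m\<close> with \<open>m \<ge> order K\<close> does, since \<open>carrier K\<close> itself is not shattered. Hence nothing
  is lost by letting \<open>m\<close> range over the natural numbers only.\<close>

definition shattering_number :: "('a, 'm) ring_scheme \<Rightarrow> nat" where
  "shattering_number K =
     (GREATEST m. \<forall>Y\<subseteq>carrier K. card Y \<le> m \<longrightarrow> shatters K (nonzero_squares K) Y)"

end

theory Submission
  imports Defs "HOL-Library.Cardinality" "HOL-Number_Theory.Residues" "HOL-Algebra.Weak_Morphisms"
    "HOL-Real_Asymp.Real_Asymp" "HOL-Computational_Algebra.Polynomial"
begin

text \<open>
  Up to a factor \<open>2 ^ n\<close>, the number of \<open>x\<close> inducing a given pattern on \<open>Y\<close>, \<open>n = card Y\<close>, is the sum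
  over \<open>x\<close> of \<open>\<Prod>y\<in>Y. 1 \<plusminus> \<chi>(y - x)\<close> with \<open>\<chi>\<close> the quadratic character. Expanding the product, the
  main term is \<open>q\<close>, and the other \<open>2 ^ n - 1\<close> terms are character sums of squarefree polynomials.
  Each of these is at most a constant times \<open>n * sqrt q\<close> by Stepanov's method: a polynomial
  \<open>f ^ M * (\<Sum>j<J. (r j + s j * f ^ ((q - 1) / 2)) * X ^ (q * j))\<close> vanishing to order \<open>M\<close> at every \<open>x\<close>
  with \<open>\<chi>(f x)\<close> equal to a prescribed sign exists by counting coefficients, and its degree bounds
  the number of such \<open>x\<close> by roughly \<open>q / 2\<close>. If \<open>2 ^ n \<le> q powr (1/2 - \<epsilon>)\<close>, the main term wins.
\<close>

section \<open>Taylor expansions of polynomials\<close>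

text \<open>\<open>taylor p\<close> is \<open>p(X + T)\<close>, with outer variable \<open>T\<close> and inner variable \<open>X\<close>; its coefficients
  are the Hasse derivatives of \<open>p\<close>, which detect multiplicities also beyond the characteristic.\<close>

definition taylor :: "'a::comm_ring_1 poly \<Rightarrow> 'a poly poly" where
  "taylor p = pcompose (map_poly (\<lambda>c. [:c:]) p) [:[:0, 1:], 1:]"

lemma taylor_0 [simp]: "taylor 0 = 0"
  by (simp add: taylor_def)

lemma taylor_pCons: "taylor (pCons a p) = [:[:a:]:] + [:[:0, 1:], 1:] * taylor p"
  by (simp add: taylor_def map_poly_pCons pcompose_pCons)

lemma taylor_const [simp]: "taylor [:a:] = [:[:a:]:]"
  by (simp add: taylor_pCons)

lemma taylor_add: "taylor (p + q) = taylor p + taylor q"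
proof (induction p arbitrary: q)
  case (pCons a p)
  obtain b q' where q: "q = pCons b q'"
    by (cases q)
  have const: "[:[:a + b:]:] = [:[:a:]:] + [:[:b:]:]"
    and sum: "pCons a p + pCons b q' = pCons (a + b) (p + q')"
    by simp_all
  show ?case
    unfolding q sum taylor_pCons pCons.IH const distrib_left by (simp only: ac_simps)
qed auto

lemma taylor_smult: "taylor (smult a p) = [:[:a:]:] * taylor p"
proof (induction p)
  case (pCons b p)
  have "[:[:a * b:]:] = [:[:a:]:] * [:[:b:]:]"
    by simp
  thus ?case
    unfolding smult_pCons taylor_pCons pCons.IH distrib_left by (simp only: ac_simps)
qed auto

lemma taylor_uminus: "taylor (- p) = - taylor p"
  using taylor_add[of "-p" p] by (simp add: eq_neg_iff_add_eq_0)

lemma taylor_diff: "taylor (p - q) = taylor p - taylor q"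
  using taylor_add[of p "-q"] by (simp add: taylor_uminus)

lemma taylor_sum: "taylor (sum f A) = (\<Sum>x\<in>A. taylor (f x))"
  by (induction A rule: infinite_finite_induct) (simp_all add: taylor_add)

lemma taylor_mult: "taylor (p * q) = taylor p * taylor q"
proof (induction p)
  case (pCons a p)
  have "taylor (pCons a p * q) = taylor (smult a q) + taylor (pCons 0 (p * q))"
    by (simp add: taylor_add)
  also have "\<dots> = [:[:a:]:] * taylor q + [:[:0, 1:], 1:] * (taylor p * taylor q)"
    by (simp only: taylor_smult taylor_pCons pCons.IH) simp
  also have "\<dots> = taylor (pCons a p) * taylor q"
    by (simp only: taylor_pCons distrib_right mult.assoc)
  finally show ?case .
qed auto

lemma taylor_power: "taylor (p ^ n) = taylor p ^ n"
  by (induction n) (simp_all add: taylor_mult one_pCons)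

lemma coeff_taylor_pCons:
  "coeff (taylor (pCons a p)) k =
     (if k = 0 then [:a:] else 0) + [:0, 1:] * coeff (taylor p) k +
     (if k = 0 then 0 else coeff (taylor p) (k - 1))"
  by (cases k) (simp_all add: taylor_pCons)

lemma coeff_0_taylor [simp]: "coeff (taylor p) 0 = p"
  by (induction p) (simp_all add: coeff_taylor_pCons)

lemma coeff_coeff_taylor_eq_0: "degree p < n \<Longrightarrow> coeff (coeff (taylor p) k) n = 0"
proof (induction p arbitrary: n k)
  case (pCons a p)
  show ?case
  proof (cases "p = 0")
    case True
    with pCons.prems show ?thesis
      by (auto simp: coeff_pCons split: nat.splits)
  next
    case False
    with pCons.prems obtain n' where n: "n = Suc n'" "degree p < n'"
      by (cases n) auto
    show ?thesis
      using n pCons.IH[of n'] pCons.IH[of n]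
      by (simp add: coeff_taylor_pCons)
  qed
qed auto

lemma degree_coeff_taylor_le: "degree (coeff (taylor p) k) \<le> degree p"
  by (rule degree_le) (simp add: coeff_coeff_taylor_eq_0)

text \<open>Setting the inner variable to the point \<open>x\<close> turns p(X + T) into p(x + T),
  so the values at \<open>x\<close> of the Hasse derivatives are the coefficients of the expansion
  of \<open>p\<close> around \<open>x\<close>.\<close>

lemma map_poly_poly_taylor: "map_poly (\<lambda>c. poly c x) (taylor p) = pcompose p [:x, 1:]"
proof (induction p)
  case (pCons a p)
  have add: "map_poly (\<lambda>c. poly c x) (u + v) = map_poly (\<lambda>c. poly c x) u + map_poly (\<lambda>c. poly c x) v"
    for u v by (rule poly_eqI) (simp add: coeff_map_poly)
  have lin: "map_poly (\<lambda>c. poly c x) ([:b, 1:] * u) = [:poly b x, 1:] * map_poly (\<lambda>c. poly c x) u"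
    for b u by (rule poly_eqI) (simp add: coeff_map_poly coeff_pCons split: nat.splits)
  show ?case
    unfolding taylor_pCons add lin pCons.IH by (simp add: map_poly_pCons pcompose_pCons)
qed auto

text \<open>If the first \<open>M\<close> coefficients of p(x + T) vanish, then T^M divides it;
  substituting X - x for T undoes the shift. No factorials are divided by, so the characteristic is
  irrelevant.\<close>

lemma power_dvd_if_coeff_taylor_root:
  fixes p :: "'a::comm_ring_1 poly"
  assumes "\<And>k. k < M \<Longrightarrow> poly (coeff (taylor p) k) x = 0"
  shows "[:-x, 1:] ^ M dvd p"
proof -
  have "coeff (pcompose p [:x, 1:]) k = 0" if "k < M" for k
    using assms[OF that] unfolding map_poly_poly_taylor[symmetric] by (simp add: coeff_map_poly)
  hence "monom 1 M dvd pcompose p [:x, 1:]"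
    by (auto simp: monom_1_dvd_iff')
  then obtain r where "pcompose p [:x, 1:] = monom 1 M * r" ..
  hence "pcompose (pcompose p [:x, 1:]) [:-x, 1:] = pcompose (monom 1 M) [:-x, 1:] * pcompose r [:-x, 1:]"
    by (simp add: pcompose_mult)
  moreover have "pcompose (pcompose p [:x, 1:]) [:-x, 1:] = p"
    by (simp flip: pcompose_assoc add: pcompose_pCons)
  moreover have "pcompose (monom 1 M) [:-x, 1:] = [:-x, 1:] ^ M"
    by (induction M) (simp_all add: monom_0 monom_Suc pcompose_pCons pcompose_1)
  ultimately show ?thesis by simp
qed

text \<open>Every point of \<open>Z\<close> is a root of order at least \<open>M\<close>, and the
  orders of all roots add up to at most the degree.\<close>

lemma mult_card_le_degree:
  fixes p :: "'a::field poly"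
  assumes "p \<noteq> 0" "M > 0" and dvd: "\<And>x. x \<in> Z \<Longrightarrow> [:-x, 1:] ^ M dvd p"
  shows "M * card Z \<le> degree p"
proof -
  have ord: "M \<le> order x p" if "x \<in> Z" for x
    using dvd[OF that] assms(1) by (simp add: order_divides)
  have sub: "Z \<subseteq> {x. poly p x = 0}"
    using ord assms(1,2) by (auto simp: order_root dest!: ord)
  have "M * card Z = (\<Sum>x\<in>Z. M)"
    by simp
  also have "\<dots> \<le> (\<Sum>x\<in>Z. order x p)"
    by (rule sum_mono) (rule ord)
  also have "\<dots> \<le> (\<Sum>x\<in>{x. poly p x = 0}. order x p)"
    by (rule sum_mono2) (use sub poly_roots_finite[OF assms(1)] in auto)
  also have "\<dots> \<le> degree p"
    by (rule sum_order_le_degree) fact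
  finally show ?thesis .
qed

text \<open>By the Leibniz rule, a Hasse derivative of order \<open>k\<close> destroys at most
  \<open>k\<close> of the \<open>N\<close> factors \<open>f\<close>. The induction splits off one
  factor at a time.\<close>

lemma coeff_taylor_power_factor:
  fixes f :: "'a::idom poly"
  assumes "k \<le> N"
  shows "\<exists>v. degree v \<le> k * degree f \<and> coeff (taylor (f ^ N)) k = f ^ (N - k) * v"
  using assms
proof (induction N arbitrary: k)
  case 0
  thus ?case by (intro exI[of _ 1]) auto
next
  case (Suc N)
  show ?case
  proof (cases "k = Suc N")
    \<comment> \<open>Here no factor \<open>f\<close> has to survive, so the whole coefficient
      serves as the cofactor; the induction hypothesis covers only orders up to
      \<open>N\<close>.\<close>
    case True
    have "degree (coeff (taylor (f ^ Suc N)) k) \<le> degree (f ^ Suc N)"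
      by (rule degree_coeff_taylor_le)
    also have "\<dots> \<le> degree f * Suc N"
      by (rule degree_power_le)
    finally show ?thesis
      using True by (intro exI[of _ "coeff (taylor (f ^ Suc N)) k"]) (simp add: mult.commute)
  next
    case False
    with Suc.prems have k: "k \<le> N" by simp
    have "\<forall>i\<in>{..k}. \<exists>v. degree v \<le> i * degree f \<and> coeff (taylor (f ^ N)) i = f ^ (N - i) * v"
      using Suc.IH k by auto
    then obtain v where v: "\<And>i. i \<le> k \<Longrightarrow> degree (v i) \<le> i * degree f"
        "\<And>i. i \<le> k \<Longrightarrow> coeff (taylor (f ^ N)) i = f ^ (N - i) * v i"
      by (metis atMost_iff)
    \<comment> \<open>The Leibniz term with i = 0 keeps the new factor \<open>f\<close> intact. For
      i \<ge> 1 the term has \<open>i - 1\<close> factors \<open>f\<close> beyond the required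
      \<open>Suc N - k\<close>, and these surplus factors go into \<open>w\<close>.\<close>
    define w where "w = v k + (\<Sum>i\<in>{1..k}. f ^ (i - 1) * coeff (taylor f) i * v (k - i))"
    have "coeff (taylor (f ^ Suc N)) k = (\<Sum>i\<le>k. coeff (taylor f) i * coeff (taylor (f ^ N)) (k - i))"
      by (simp add: taylor_mult coeff_mult)
    also have "\<dots> = f * coeff (taylor (f ^ N)) k + (\<Sum>i\<in>{1..k}. coeff (taylor f) i * coeff (taylor (f ^ N)) (k - i))"
      by (simp add: atMost_atLeast0 sum.atLeast_Suc_atMost)
    also have "f * coeff (taylor (f ^ N)) k = f ^ (Suc N - k) * v k"
      using v(2)[of k] k by (simp add: Suc_diff_le)
    also have "(\<Sum>i\<in>{1..k}. coeff (taylor f) i * coeff (taylor (f ^ N)) (k - i)) =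
               (\<Sum>i\<in>{1..k}. f ^ (Suc N - k) * (f ^ (i - 1) * coeff (taylor f) i * v (k - i)))"
    proof (rule sum.cong)
      fix i assume i: "i \<in> {1..k}"
      hence "N - (k - i) = (Suc N - k) + (i - 1)"
        using k by auto
      hence "f ^ (N - (k - i)) = f ^ (Suc N - k) * f ^ (i - 1)"
        by (simp only: power_add)
      moreover have "coeff (taylor (f ^ N)) (k - i) = f ^ (N - (k - i)) * v (k - i)"
        by (intro v(2)) auto
      ultimately show "coeff (taylor f) i * coeff (taylor (f ^ N)) (k - i) =
            f ^ (Suc N - k) * (f ^ (i - 1) * coeff (taylor f) i * v (k - i))"
        by (simp only: mult_ac)
    qed simp
    finally have "coeff (taylor (f ^ Suc N)) k = f ^ (Suc N - k) * w"
      by (simp add: w_def sum_distrib_left distrib_left)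
    moreover have "degree w \<le> k * degree f"
      unfolding w_def
    proof (intro degree_add_le degree_sum_le)
      fix i assume i: "i \<in> {1..k}"
      have "degree (f ^ (i - 1) * coeff (taylor f) i * v (k - i)) \<le>
            degree f * (i - 1) + degree f + (k - i) * degree f"
        by (intro order.trans[OF degree_mult_le] add_mono degree_power_le degree_coeff_taylor_le v(1)) auto
      also have "\<dots> = (i - 1 + 1 + (k - i)) * degree f"
        by (simp add: algebra_simps)
      also have "i - 1 + 1 + (k - i) = k"
        using i by auto
      finally show "degree (f ^ (i - 1) * coeff (taylor f) i * v (k - i)) \<le> k * degree f" .
    qed (use v(1)[of k] in auto)
    ultimately show ?thesis by blast
  qed
qed

text \<open>One cofactor map \<open>W\<close> serves all \<open>h\<close> simultaneously and
  respects differences. Thus the vanishing conditions of Stepanov's method are additive in the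
  unknown polynomials.\<close>

lemma coeff_taylor_power_mult_factor:
  fixes f :: "'a::idom poly"
  obtains W where
    "\<And>k h. k \<le> N \<Longrightarrow> coeff (taylor (f ^ N * h)) k = f ^ (N - k) * W k h"
    "\<And>k h. k \<le> N \<Longrightarrow> degree (W k h) \<le> k * degree f + degree h"
    "\<And>k h h'. W k (h - h') = W k h - W k h'"
proof -
  have "\<forall>i\<in>{..N}. \<exists>v. degree v \<le> i * degree f \<and> coeff (taylor (f ^ N)) i = f ^ (N - i) * v"
    using coeff_taylor_power_factor by auto
  then obtain v where v: "\<And>i. i \<le> N \<Longrightarrow> degree (v i) \<le> i * degree f"
      "\<And>i. i \<le> N \<Longrightarrow> coeff (taylor (f ^ N)) i = f ^ (N - i) * v i"
    by (metis atMost_iff)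
  define W where "W = (\<lambda>k h. \<Sum>i\<le>k. f ^ (k - i) * v i * coeff (taylor h) (k - i))"
  show ?thesis
  proof (rule that[of W])
    fix k h assume k: "k \<le> N"
    have "coeff (taylor (f ^ N * h)) k = (\<Sum>i\<le>k. coeff (taylor (f ^ N)) i * coeff (taylor h) (k - i))"
      by (simp add: taylor_mult coeff_mult)
    also have "\<dots> = (\<Sum>i\<le>k. f ^ (N - k) * (f ^ (k - i) * v i * coeff (taylor h) (k - i)))"
    proof (rule sum.cong)
      fix i assume i: "i \<in> {..k}"
      hence "N - i = (N - k) + (k - i)"
        using k by auto
      hence "f ^ (N - i) = f ^ (N - k) * f ^ (k - i)"
        by (simp only: power_add)
      moreover have "coeff (taylor (f ^ N)) i = f ^ (N - i) * v i"
        using i k by (intro v(2)) auto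
      ultimately show "coeff (taylor (f ^ N)) i * coeff (taylor h) (k - i) =
            f ^ (N - k) * (f ^ (k - i) * v i * coeff (taylor h) (k - i))"
        by (simp only: mult_ac)
    qed simp
    finally show "coeff (taylor (f ^ N * h)) k = f ^ (N - k) * W k h"
      by (simp add: W_def sum_distrib_left)
    show "degree (W k h) \<le> k * degree f + degree h"
      unfolding W_def
    proof (intro degree_sum_le)
      fix i assume i: "i \<in> {..k}"
      have "degree (f ^ (k - i) * v i * coeff (taylor h) (k - i)) \<le>
            degree f * (k - i) + i * degree f + degree h"
        by (intro order.trans[OF degree_mult_le] add_mono degree_power_le degree_coeff_taylor_le v(1))
           (use i k in auto)
      also have "\<dots> = (k - i + i) * degree f + degree h"
        by (simp add: algebra_simps)
      also have "k - i + i = k"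
        using i by auto
      finally show "degree (f ^ (k - i) * v i * coeff (taylor h) (k - i)) \<le> k * degree f + degree h" .
    qed auto
  qed (simp add: W_def taylor_diff right_diff_distrib sum_subtractf)
qed

section \<open>Stepanov's method\<close>

text \<open>The polynomial (1 + X)^q - 1 - X^q vanishes at all q elements, since a^q = a, but its
  coefficient at X^q cancels, so its degree is less than q. Hence it is zero. This covers prime
  powers directly.\<close>

lemma of_nat_card_choose_eq_0:
  assumes "0 < i" "i < CARD('a)"
  shows "of_nat (CARD('a) choose i) = (0 :: 'a::finite_field)"
proof -
  let ?q = "CARD('a)"
  define p :: "'a poly" where "p = [:1, 1:] ^ ?q - 1 - monom 1 ?q"
  have coeff_p: "coeff p n = (if n = 0 \<or> n = ?q then 0 else of_nat (?q choose n))" if "n \<le> ?q" for n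
    using assms that by (auto simp: p_def coeff_linear_poly_power)
  have "p = 0"
  proof (rule ccontr)
    assume "p \<noteq> 0"
    have "poly p x = 0" for x
      by (simp add: p_def poly_monom finite_field_power_card_eq_same)
    hence "?q \<le> degree p"
      using card_poly_roots_bound[OF \<open>p \<noteq> 0\<close>] by simp
    moreover have "degree p \<le> ?q"
      unfolding p_def
      by (intro degree_diff_le degree_monom_le order.trans[OF degree_power_le]) auto
    ultimately have "degree p = ?q"
      by simp
    thus False
      using \<open>p \<noteq> 0\<close> coeff_p[of ?q] by (metis leading_coeff_0_iff order_refl)
  qed
  thus ?thesis
    using coeff_p[of i] assms by simp
qed

lemma of_nat_card_choose_poly_eq_0:
  assumes "0 < i" "i < CARD('a)"
  shows "of_nat (CARD('a) choose i) = (0 :: 'a::finite_field poly)"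
  using of_nat_card_choose_eq_0[OF assms] by (simp add: of_nat_poly)

text \<open>Since (X + T)^q = X^q + T^q, powers of X^q behave like constants under Hasse derivatives
  of order less than q.\<close>

lemma coeff_taylor_monom_card_mult:
  fixes p :: "'a::finite_field poly"
  assumes "k < CARD('a)"
  shows "coeff (taylor (p * monom 1 (CARD('a) * j))) k = coeff (taylor p) k * monom 1 (CARD('a) * j)"
  using assms
proof (induction j arbitrary: k)
  case (Suc j)
  let ?q = "CARD('a)"
  let ?u = "p * monom 1 (?q * j)"
  have X: "taylor (monom 1 1) = [:[:0, 1:], 1 :: 'a poly:]"
    by (simp add: monom_Suc monom_0 taylor_pCons)
  have X_q: "coeff (taylor (monom 1 ?q)) i = (if i = 0 then monom 1 ?q else 0 :: 'a poly)"
    if "i < ?q" for i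
  proof -
    have "taylor (monom 1 ?q) = [:[:0, 1:], 1 :: 'a poly:] ^ ?q"
      unfolding X[symmetric] taylor_power[symmetric] by (simp add: monom_power)
    hence "coeff (taylor (monom 1 ?q)) i = of_nat (?q choose i) * [:0, 1 :: 'a:] ^ (?q - i)"
      using that by (simp add: coeff_linear_poly_power)
    thus ?thesis
      using of_nat_card_choose_poly_eq_0[of i, where 'a = 'a] that by (auto simp: monom_altdef)
  qed
  have shift: "p * monom 1 (?q * Suc j) = monom 1 ?q * ?u"
    by (simp add: mult_monom mult.left_commute)
  have "coeff (taylor (p * monom 1 (?q * Suc j))) k =
         (\<Sum>i\<le>k. coeff (taylor (monom 1 ?q)) i * coeff (taylor ?u) (k - i))"
    unfolding shift taylor_mult[of "monom 1 ?q" ?u] by (simp only: coeff_mult)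
  also have "\<dots> = (\<Sum>i\<le>k. if i = 0 then monom 1 ?q * coeff (taylor ?u) k else 0)"
    by (rule sum.cong) (use Suc.prems in \<open>auto simp: X_q\<close>)
  also have "\<dots> = monom 1 ?q * coeff (taylor ?u) k"
    by simp
  also have "\<dots> = coeff (taylor p) k * monom 1 (?q * Suc j)"
    using Suc.IH[OF Suc.prems] by (simp add: mult_monom mult.left_commute)
  finally show ?case .
qed (simp add: monom_0 flip: one_pCons)

lemma power_card_add:
  fixes x y :: "'a::finite_field poly"
  shows "(x + y) ^ CARD('a) = x ^ CARD('a) + y ^ CARD('a)"
proof -
  let ?q = "CARD('a)"
  have "(x + y) ^ ?q = (\<Sum>k\<le>?q. of_nat (?q choose k) * x ^ k * y ^ (?q - k))"
    by (rule binomial_ring)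
  also have "\<dots> = (\<Sum>k\<in>{0, ?q}. of_nat (?q choose k) * x ^ k * y ^ (?q - k))"
    by (rule sum.mono_neutral_right) (auto simp: of_nat_card_choose_poly_eq_0)
  also have "\<dots> = x ^ ?q + y ^ ?q"
    using zero_less_card_finite[where 'a = 'a] by simp
  finally show ?thesis .
qed

text \<open>Writing f = c + X g, the Frobenius gives f^q = c^q + X^q g^q, and c^q = c =
  f(0).\<close>

lemma monom_card_dvd_power_card_diff:
  fixes f :: "'a::finite_field poly"
  shows "monom 1 CARD('a) dvd f ^ CARD('a) - [:poly f 0:]"
proof -
  let ?q = "CARD('a)"
  obtain c g where f: "f = pCons c g"
    by (cases f)
  have "f = [:c:] + monom 1 1 * g"
    by (simp add: f monom_Suc monom_0)
  hence "f ^ ?q = [:c:] ^ ?q + (monom 1 1 * g) ^ ?q"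
    by (simp only: power_card_add)
  also have "[:c:] ^ ?q = [:poly f 0:]"
    by (simp add: f poly_const_pow finite_field_power_card_eq_same)
  also have "(monom 1 1 * g) ^ ?q = monom 1 ?q * g ^ ?q"
    by (simp add: power_mult_distrib monom_power)
  finally show ?thesis
    by simp
qed

text \<open>The space of dimension \<open>D\<close> of polynomials of degree less than
  \<open>D\<close>. The condition on coefficients keeps the zero polynomial in it even for
  \<open>D = 0\<close>.\<close>

definition polys_below :: "nat \<Rightarrow> 'a::zero poly set" where
  "polys_below D = {p. \<forall>i\<ge>D. coeff p i = 0}"

lemma polys_belowI: "degree p < D \<Longrightarrow> p \<in> polys_below D"
  by (auto simp: polys_below_def coeff_eq_0)

lemma polys_below_degree: "p \<in> polys_below D \<Longrightarrow> D > 0 \<Longrightarrow> degree p < D"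
  by (auto simp: polys_below_def intro!: degree_lessI)

lemma polys_below_diff:
  "p \<in> polys_below D \<Longrightarrow> q \<in> polys_below D \<Longrightarrow> p - q \<in> polys_below D"
  for p q :: "'a::ab_group_add poly"
  by (auto simp: polys_below_def)

lemma bij_betw_polys_below:
  "bij_betw (\<lambda>p. restrict (coeff p) {..<D}) (polys_below D)
     ({..<D} \<rightarrow>\<^sub>E (UNIV :: 'a::comm_monoid_add set))"
proof (rule bij_betw_byWitness[where f' = "\<lambda>g. \<Sum>i<D. monom (g i) i"])
  have coeff_sum_monom: "coeff (\<Sum>i<D. monom (g i) i) n = (if n < D then g n else 0)"
    for g :: "nat \<Rightarrow> 'a" and n
    by (simp add: coeff_sum)
  show "\<forall>p\<in>polys_below D :: 'a poly set. (\<Sum>i<D. monom (restrict (coeff p) {..<D} i) i) = p"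
    unfolding poly_eq_iff coeff_sum_monom by (simp add: polys_below_def)
  show "\<forall>g\<in>{..<D} \<rightarrow>\<^sub>E (UNIV :: 'a set). restrict (coeff (\<Sum>i<D. monom (g i) i)) {..<D} = g"
    unfolding coeff_sum_monom by (auto simp: PiE_def extensional_def restrict_def)
  show "(\<lambda>g. \<Sum>i<D. monom (g i) i) ` ({..<D} \<rightarrow>\<^sub>E (UNIV :: 'a set)) \<subseteq> polys_below D"
    unfolding polys_below_def by (intro image_subsetI CollectI allI impI) (simp only: coeff_sum_monom not_less[symmetric] if_False)
qed (auto split: if_splits)

lemma finite_polys_below: "finite (polys_below D :: 'a::{finite,comm_monoid_add} poly set)"
  using bij_betw_finite[OF bij_betw_polys_below[of D, where 'a = 'a]] by (simp add: finite_PiE)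

lemma card_polys_below: "card (polys_below D :: 'a::{finite,comm_monoid_add} poly set) = CARD('a) ^ D"
  using bij_betw_same_card[OF bij_betw_polys_below[of D, where 'a = 'a]] by (simp add: card_PiE)

text \<open>There are \<open>2 * J * D\<close> free coefficients in \<open>r\<close> and
  \<open>s\<close>. Each of the \<open>M\<close> conditions concerns a polynomial with fewer than
  \<open>D + d + J\<close> coefficients. By the pigeonhole principle two different choices have the
  same image, and by additivity their difference is a nontrivial solution.\<close>

lemma auxiliary_system_solvable:
  fixes U V :: "nat \<Rightarrow> 'a::finite_field poly \<Rightarrow> 'a poly" and c :: 'a
  assumes U: "\<And>k h h'. U k (h - h') = U k h - U k h'" "\<And>k h. k < M \<Longrightarrow> degree (U k h) \<le> d + degree h"
    and V: "\<And>k h h'. V k (h - h') = V k h - V k h'" "\<And>k h. k < M \<Longrightarrow> degree (V k h) \<le> d + degree h"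
    and less: "M * (D + d + J) < 2 * J * D"
  obtains r s where "\<And>j. r j \<in> polys_below D" "\<And>j. s j \<in> polys_below D"
    "\<exists>j<J. r j \<noteq> 0 \<or> s j \<noteq> 0"
    "\<And>k. k < M \<Longrightarrow> (\<Sum>j<J. (U k (r j) + smult c (V k (s j))) * monom 1 j) = 0"
proof -
  let ?q = "CARD('a)" and ?P = "polys_below D :: 'a poly set"
  define E where "E = D + d + J"
  define A where "A = ({..<J} \<rightarrow>\<^sub>E ?P \<times> ?P)"
  define B where "B = ({..<M} \<rightarrow>\<^sub>E (polys_below E :: 'a poly set))"
  define \<sigma> where "\<sigma> = (\<lambda>x k. \<Sum>j<J. (U k (fst (x j)) + smult c (V k (snd (x j)))) * monom 1 j)"
  have D: "D > 0"
    using less by (cases D) auto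
  have "restrict (\<sigma> x) {..<M} \<in> B" if x: "x \<in> A" for x
    unfolding B_def
  proof (intro PiE_I)
    fix k assume k: "k \<in> {..<M}"
    have "degree ((U k (fst (x j)) + smult c (V k (snd (x j)))) * monom 1 j) \<le> E - 1" if "j < J" for j
    proof -
      have deg: "degree (fst (x j)) < D" "degree (snd (x j)) < D"
        using x that D by (auto simp: A_def PiE_iff mem_Times_iff intro!: polys_below_degree)
      have "degree (U k (fst (x j)) + smult c (V k (snd (x j)))) \<le> d + (D - 1)"
        by (intro degree_add_le order.trans[OF degree_smult_le] order.trans[OF U(2)] order.trans[OF V(2)])
           (use k deg in auto)
      hence "degree ((U k (fst (x j)) + smult c (V k (snd (x j)))) * monom 1 j) \<le> (d + (D - 1)) + j"
        by (intro order.trans[OF degree_mult_le] add_mono degree_monom_le)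
      thus ?thesis
        using that by (simp add: E_def)
    qed
    hence "degree (\<sigma> x k) \<le> E - 1"
      unfolding \<sigma>_def by (intro degree_sum_le) auto
    thus "restrict (\<sigma> x) {..<M} k \<in> polys_below E"
      using k D by (auto intro!: polys_belowI simp: E_def)
  qed auto
  hence "(\<lambda>x. restrict (\<sigma> x) {..<M}) ` A \<subseteq> B"
    by blast
  moreover have "card B < card A"
  proof -
    have "card {0, 1 :: 'a} \<le> ?q"
      by (intro card_mono) auto
    hence "?q > 1"
      by simp
    moreover have "card B = ?q ^ (E * M)"
      by (simp add: B_def card_PiE card_polys_below power_mult)
    moreover have "card A = ?q ^ ((D + D) * J)"
      by (simp add: A_def card_PiE card_cartesian_product card_polys_below power_mult power_add)
    moreover have "E * M < (D + D) * J"
      using less by (simp add: E_def algebra_simps)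
    ultimately show ?thesis
      by (simp add: power_strict_increasing)
  qed
  moreover have "finite B"
    unfolding B_def by (intro finite_PiE finite_polys_below) auto
  ultimately have "\<not> inj_on (\<lambda>x. restrict (\<sigma> x) {..<M}) A"
    using card_inj_on_le[of _ A B] by fastforce
  then obtain x y where xy: "x \<in> A" "y \<in> A" "x \<noteq> y" "restrict (\<sigma> x) {..<M} = restrict (\<sigma> y) {..<M}"
    by (auto simp: inj_on_def)
  \<comment> \<open>The default value 0 beyond \<open>J\<close> puts \<open>r j\<close> and
    \<open>s j\<close> into \<open>polys_below D\<close> for every \<open>j\<close>.\<close>
  define r s where "r = (\<lambda>j. if j < J then fst (x j) - fst (y j) else 0)"
    and "s = (\<lambda>j. if j < J then snd (x j) - snd (y j) else 0)"
  show ?thesis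
  proof (rule that[of r s])
    have xyP: "x j \<in> ?P \<times> ?P" "y j \<in> ?P \<times> ?P" if "j < J" for j
      using xy(1,2) that by (auto simp: A_def PiE_iff)
    show "r j \<in> polys_below D" "s j \<in> polys_below D" for j
      using xyP[of j] polys_belowI[of "0 :: 'a poly" D] D
      by (auto simp: r_def s_def mem_Times_iff intro!: polys_below_diff)
    show "\<exists>j<J. r j \<noteq> 0 \<or> s j \<noteq> 0"
    proof -
      have "\<exists>j<J. x j \<noteq> y j"
        using xy(1-3) unfolding A_def by (metis PiE_ext lessThan_iff)
      thus ?thesis
        by (auto simp: r_def s_def prod_eq_iff)
    qed
    fix k assume k: "k < M"
    have "(\<Sum>j<J. (U k (r j) + smult c (V k (s j))) * monom 1 j) = \<sigma> x k - \<sigma> y k"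
      unfolding \<sigma>_def sum_subtractf[symmetric]
      by (rule sum.cong) (auto simp: r_def s_def U V smult_diff_right algebra_simps)
    also have "\<sigma> x k = \<sigma> y k"
      using fun_cong[OF xy(4), of k] k by simp
    finally show "(\<Sum>j<J. (U k (r j) + smult c (V k (s j))) * monom 1 j) = 0"
      by simp
  qed
qed

text \<open>Multiplying by \<open>(r - s * f ^ h) * f\<close> removes the large power of \<open>f\<close>: modulo \<open>X ^ q\<close> the
  product is \<open>r\<^sup>2 * f - f(0) * s\<^sup>2\<close>, which has degree less than \<open>q\<close> and hence vanishes; the parity of
  the order at \<open>b\<close> then forces \<open>r = s = 0\<close>.\<close>

lemma monom_card_dvd_imp_zero:
  fixes f :: "'a::finite_field poly"
  assumes f: "poly f 0 \<noteq> 0" "odd (order b f)" and h: "2 * h + 1 = CARD('a)"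
    and D: "2 * D + degree f \<le> CARD('a) + 1"
    and rs: "r \<in> polys_below D" "s \<in> polys_below D" and dvd: "monom 1 CARD('a) dvd r + s * f ^ h"
  shows "r = 0 \<and> s = 0"
proof (cases "D = 0")
  case True
  thus ?thesis
    using rs by (auto simp: polys_below_def poly_eq_iff)
next
  case False
  let ?q = "CARD('a)" and ?c = "poly f 0"
  have "f \<noteq> 0"
    using f by auto
  have "monom 1 ?q dvd (r + s * f ^ h) * (r - s * f ^ h) * f + s\<^sup>2 * (f ^ ?q - [:?c:])"
    by (intro dvd_add dvd_mult2 dvd dvd_mult monom_card_dvd_power_card_diff)
  \<comment> \<open>As 2h + 1 = q, both summands contain s^2 f^q, with opposite signs.\<close>
  also have "(r + s * f ^ h) * (r - s * f ^ h) * f + s\<^sup>2 * (f ^ ?q - [:?c:]) = r\<^sup>2 * f - smult ?c (s\<^sup>2)"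
    unfolding h[symmetric] by (simp add: algebra_simps power2_eq_square power_mult)
  finally have "monom 1 ?q dvd r\<^sup>2 * f - smult ?c (s\<^sup>2)" .
  \<comment> \<open>The degrees of \<open>r\<close> and \<open>s\<close> are at most
    \<open>D - 1\<close>, and \<open>2 * (D - 1) + degree f\<close> is at most q - 1.\<close>
  moreover have "degree (r\<^sup>2 * f - smult ?c (s\<^sup>2)) < ?q"
  proof -
    have deg: "degree r < D" "degree s < D"
      using rs False by (auto intro!: polys_below_degree)
    have "degree (r\<^sup>2 * f) \<le> degree r * 2 + degree f"
      by (intro order.trans[OF degree_mult_le] add_mono degree_power_le) auto
    moreover have "degree (smult ?c (s\<^sup>2)) \<le> degree s * 2"
      by (intro order.trans[OF degree_smult_le] degree_power_le)
    ultimately show ?thesis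
      using deg D by (intro degree_diff_less) auto
  qed
  ultimately have eq: "r\<^sup>2 * f = smult ?c (s\<^sup>2)"
    by (metis dvd_imp_degree_le degree_monom_eq eq_iff_diff_eq_0 linorder_not_less zero_neq_one)
  have "s = 0 \<longleftrightarrow> r = 0"
    using arg_cong[OF eq, of "\<lambda>p. p = 0"] f \<open>f \<noteq> 0\<close> by auto
  moreover have "r = 0"
  proof (rule ccontr)
    assume "r \<noteq> 0"
    hence "s \<noteq> 0"
      using calculation by simp
    have "order b (r\<^sup>2 * f) = 2 * order b r + order b f"
      using \<open>r \<noteq> 0\<close> \<open>f \<noteq> 0\<close> by (simp add: order_mult power2_eq_square)
    moreover have "order b (smult ?c (s\<^sup>2)) = 2 * order b s"
      using \<open>s \<noteq> 0\<close> f by (simp add: order_smult order_mult power2_eq_square)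
    ultimately have "2 * order b r + order b f = 2 * order b s"
      using eq by simp
    thus False
      using f(2) by presburger
  qed
  ultimately show ?thesis by simp
qed

text \<open>All terms with j > 0 are divisible by X^q, so the term j = 0 is too, which forces
  \<open>r 0\<close> and \<open>s 0\<close> to vanish. Dividing by X^q leaves a sum of the same
  shape with one term fewer.\<close>

lemma auxiliary_polynomial_nonzero:
  fixes f :: "'a::finite_field poly"
  assumes f: "poly f 0 \<noteq> 0" "odd (order b f)" and h: "2 * h + 1 = CARD('a)"
    and D: "2 * D + degree f \<le> CARD('a) + 1"
    and rs: "\<And>j. r j \<in> polys_below D" "\<And>j. s j \<in> polys_below D"
    and sum: "(\<Sum>j<J. (r j + s j * f ^ h) * monom 1 (CARD('a) * j)) = 0"
  shows "\<forall>j<J. r j = 0 \<and> s j = 0"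
  using rs sum
proof (induction J arbitrary: r s)
  case (Suc J)
  let ?q = "CARD('a)"
  define Q where "Q = (\<Sum>j<J. (r (Suc j) + s (Suc j) * f ^ h) * monom 1 (?q * j))"
  have "monom 1 (?q + ?q * j) = monom 1 ?q * (monom 1 (?q * j) :: 'a poly)" for j
    by (simp add: mult_monom)
  hence "0 = (r 0 + s 0 * f ^ h) + monom 1 ?q * Q"
    unfolding Suc.prems(3)[symmetric] sum.lessThan_Suc_shift Q_def sum_distrib_left
    by (simp add: monom_0 mult_ac flip: one_pCons)
  hence *: "r 0 + s 0 * f ^ h = monom 1 ?q * (- Q)"
    by (simp add: eq_neg_iff_add_eq_0)
  hence rs0: "r 0 = 0 \<and> s 0 = 0"
    using monom_card_dvd_imp_zero[OF f h D Suc.prems(1)[of 0] Suc.prems(2)[of 0]] by auto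
  hence "Q = 0"
    using * by (simp add: monom_eq_0_iff)
  hence "\<forall>j<J. r (Suc j) = 0 \<and> s (Suc j) = 0"
    unfolding Q_def using Suc.prems(1,2) by (intro Suc.IH) auto
  with rs0 show ?case
    by (auto simp: less_Suc_eq_0_disj)
qed auto

text \<open>On the set in question \<open>f ^ h = c\<close> and \<open>X ^ q = X\<close>, so up to a power of \<open>f\<close> the \<open>k\<close>-th Hasse
  derivative of the auxiliary polynomial \<open>R\<close> takes the values of a polynomial of low degree, whose
  vanishing is the linear system solved above.\<close>

lemma stepanov_bound:
  fixes f :: "'a::finite_field poly" and c :: 'a
  assumes f: "poly f 0 \<noteq> 0" "odd (order b f)" and h: "2 * h + 1 = CARD('a)"
    and D: "2 * D + degree f \<le> CARD('a) + 1" and M: "0 < M" "M \<le> CARD('a)"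
    and less: "M * (D + M * degree f + J) < 2 * J * D"
  shows "M * card {x. poly f x ^ h = c} \<le> M * degree f + D + h * degree f + CARD('a) * J"
proof -
  let ?q = "CARD('a)" and ?m = "degree f"
  obtain U where U: "\<And>k g. k \<le> M \<Longrightarrow> coeff (taylor (f ^ M * g)) k = f ^ (M - k) * U k g"
    "\<And>k g. k \<le> M \<Longrightarrow> degree (U k g) \<le> k * ?m + degree g" "\<And>k g g'. U k (g - g') = U k g - U k g'"
    by (rule coeff_taylor_power_mult_factor[of M f]) blast
  obtain V where V: "\<And>k g. k \<le> M + h \<Longrightarrow> coeff (taylor (f ^ (M + h) * g)) k = f ^ (M + h - k) * V k g"
    "\<And>k g. k \<le> M + h \<Longrightarrow> degree (V k g) \<le> k * ?m + degree g" "\<And>k g g'. V k (g - g') = V k g - V k g'"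
    by (rule coeff_taylor_power_mult_factor[of "M + h" f]) blast
  have degU: "degree (U k g) \<le> M * ?m + degree g" if "k < M" for k g
    using that by (intro order.trans[OF U(2)] add_mono mult_mono) auto
  have degV: "degree (V k g) \<le> M * ?m + degree g" if "k < M" for k g
    using that by (intro order.trans[OF V(2)] add_mono mult_mono) auto
  obtain r s where rs: "\<And>j. r j \<in> polys_below D" "\<And>j. s j \<in> polys_below D"
      and nz: "\<exists>j<J. r j \<noteq> 0 \<or> s j \<noteq> 0"
      and van: "\<And>k. k < M \<Longrightarrow> (\<Sum>j<J. (U k (r j) + smult c (V k (s j))) * monom 1 j) = 0"
    by (rule auxiliary_system_solvable[of U M "M * ?m" V D J c]) (use U(3) degU V(3) degV less in blast)+
  \<comment> \<open>The factor \<open>f ^ M\<close> ensures that after \<open>k < M\<close>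
    derivatives both the \<open>r\<close> part and the \<open>s\<close> part still contain
    \<open>f ^ (M - k)\<close>.\<close>
  define R where "R = f ^ M * (\<Sum>j<J. (r j + s j * f ^ h) * monom 1 (?q * j))"
  have "f \<noteq> 0"
    using f by auto
  have "(\<Sum>j<J. (r j + s j * f ^ h) * monom 1 (?q * j)) \<noteq> 0"
    using auxiliary_polynomial_nonzero[where r = r and s = s and J = J, OF f h D rs] nz by blast
  hence "R \<noteq> 0"
    using \<open>f \<noteq> 0\<close> by (simp add: R_def)
  have R_eq: "R = (\<Sum>j<J. (f ^ M * r j + f ^ (M + h) * s j) * monom 1 (?q * j))"
    unfolding R_def sum_distrib_left by (simp add: algebra_simps power_add)
  have "[:-x, 1:] ^ M dvd R" if x: "poly f x ^ h = c" for x
  proof (rule power_dvd_if_coeff_taylor_root)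
    fix k assume k: "k < M"
    have pow: "x ^ (?q * j) = x ^ j" for j
      by (simp add: power_mult finite_field_power_card_eq_same)
    have "coeff (taylor R) k =
          (\<Sum>j<J. (f ^ (M - k) * U k (r j) + f ^ (M + h - k) * V k (s j)) * monom 1 (?q * j))"
      unfolding R_eq taylor_sum coeff_sum
    proof (rule sum.cong)
      fix j
      show "coeff (taylor ((f ^ M * r j + f ^ (M + h) * s j) * monom 1 (?q * j))) k =
            (f ^ (M - k) * U k (r j) + f ^ (M + h - k) * V k (s j)) * monom 1 (?q * j)"
        using k M U(1)[of k "r j"] V(1)[of k "s j"]
        by (subst coeff_taylor_monom_card_mult) (simp_all add: taylor_add)
    qed simp
    also have "poly \<dots> x = poly f x ^ (M - k) * (\<Sum>j<J. (poly (U k (r j)) x + c * poly (V k (s j)) x) * x ^ j)"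
    proof -
      have "f ^ (M + h - k) = f ^ (M - k) * f ^ h"
        using k by (simp flip: power_add)
      thus ?thesis
        by (simp add: poly_sum poly_monom pow x sum_distrib_left) (simp add: algebra_simps)
    qed
    also have "(\<Sum>j<J. (poly (U k (r j)) x + c * poly (V k (s j)) x) * x ^ j) =
               poly (\<Sum>j<J. (U k (r j) + smult c (V k (s j))) * monom 1 j) x"
      by (simp add: poly_sum poly_monom)
    finally show "poly (coeff (taylor R) k) x = 0"
      using van[OF k] by simp
  qed
  hence "M * card {x. poly f x ^ h = c} \<le> degree R"
    using \<open>R \<noteq> 0\<close> M by (intro mult_card_le_degree) auto
  \<comment> \<open>The dominant term is \<open>?q * J\<close>: for \<open>J\<close> near
    \<open>M / 2\<close>, division by \<open>M\<close> leaves about q / 2 points.\<close>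
  also have "degree R \<le> ?m * M + (D + ?m * h + ?q * J)"
    unfolding R_def
  proof (rule order.trans[OF degree_mult_le], intro add_mono degree_power_le degree_sum_le)
    fix j assume j: "j \<in> {..<J}"
    have "D > 0"
      using less by (cases D) auto
    hence deg: "degree (r j) < D" "degree (s j) < D"
      using rs by (auto intro!: polys_below_degree)
    have "degree (s j * f ^ h) \<le> D + ?m * h"
      using deg by (intro order.trans[OF degree_mult_le] add_mono degree_power_le) auto
    hence "degree (r j + s j * f ^ h) \<le> D + ?m * h"
      using deg by (intro degree_add_le) auto
    moreover have "degree (monom (1 :: 'a) (?q * j)) \<le> ?q * J"
      using j by (intro order.trans[OF degree_monom_le]) auto
    ultimately show "degree ((r j + s j * f ^ h) * monom 1 (?q * j)) \<le> D + ?m * h + ?q * J"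
      by (intro order.trans[OF degree_mult_le] add_mono)
  qed auto
  finally show ?thesis
    by (simp add: algebra_simps)
qed

section \<open>Quadratic character sums\<close>

text \<open>The parameters are those of Stepanov's method with \<open>M = 2 * t\<close> close to \<open>sqrt q\<close>,
  \<open>D\<close> close to \<open>q / 2\<close> and \<open>J\<close> exceeding \<open>M / 2\<close> by a multiple of the degree.\<close>

lemma card_poly_power_eq_le:
  fixes f :: "'a::finite_field poly" and c :: 'a
  assumes f: "poly f 0 \<noteq> 0" "odd (order b f)" and q: "odd CARD('a)"
    and small: "20 * real (degree f) < sqrt CARD('a)"
  shows "real (card {x. poly f x ^ (CARD('a) div 2) = c}) \<le>
           real CARD('a) / 2 + 6 * real (degree f) * sqrt CARD('a)"
proof -
  define q m w N where "q = CARD('a)" and "m = degree f" and "w = sqrt q"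
    and "N = card {x. poly f x ^ (CARD('a) div 2) = c}"
  have "f \<noteq> 0"
    using f by auto
  hence "order b f \<le> m"
    unfolding m_def by (rule order_degree)
  hence m: "m \<ge> 1"
    using f(2) by (cases "order b f") auto
  have w: "w * w = q" "20 * real m < w" "w > 20"
    using small m by (auto simp: w_def q_def m_def)
  define t D J where "t = nat \<lfloor>w / 2\<rfloor>" and "D = (q - m) div 2" and "J = t + 2 * m + 2"
  have t: "2 * real t \<le> w" "w - 2 < 2 * real t"
    using w unfolding t_def by linarith+
  have wq: "20 * w < q"
    using w mult_strict_right_mono[of 20 w w] by simp
  have mq: "m < q"
    using w wq by linarith
  have D: "2 * real D \<le> q - m" "real q - m - 1 \<le> 2 * real D"
    using mq unfolding D_def by linarith+
  have h: "2 * (q div 2) + 1 = q"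
    using q by (simp add: q_def)
  have tt: "4 * (real t * real t) \<le> q"
    using mult_mono[OF t(1) t(1)] w by simp
  \<comment> \<open>With \<open>J = t + 2 * m + 2\<close>, the term \<open>2 * t * D\<close> cancels
    and \<open>t * (2 * t * m + J) < D * (2 * m + 2)\<close> remains. The left side is roughly at
    most \<open>q / 4 * (2 * m + 1)\<close>, while \<open>D\<close> is close to
    \<open>q / 2\<close>.\<close>
  have less: "2 * t * (D + 2 * t * m + J) < 2 * J * D"
  proof -
    have "real t * (2 * t * m + t + 2 * m + 2) = (real t * real t) * (2 * m + 1) + real t * (2 * m + 2)"
      by (simp add: algebra_simps)
    also have "\<dots> \<le> q / 4 * (2 * m + 1) + w / 2 * (2 * m + 2)"
      by (intro add_mono mult_right_mono) (use tt t in linarith)+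
    also have "\<dots> \<le> q / 4 * (2 * m + 2) + w / 2 * (2 * m + 2)"
      using w by (intro add_mono mult_left_mono) auto
    also have "\<dots> = (q / 4 + w / 2) * (2 * m + 2)"
      by (simp add: algebra_simps)
    also have "\<dots> < real D * (2 * m + 2)"
    proof (rule mult_strict_right_mono)
      show "q / 4 + w / 2 < D"
        using D w wq by linarith
    qed simp
    finally have "real (t * (2 * t * m + t + 2 * m + 2)) < real (D * (2 * m + 2))"
      by (simp only: of_nat_mult)
    hence "t * (2 * t * m + t + 2 * m + 2) < D * (2 * m + 2)"
      by (simp only: of_nat_less_iff)
    thus ?thesis
      unfolding J_def by (simp add: algebra_simps)
  qed
  have "2 * t * N \<le> 2 * t * m + D + (q div 2) * m + q * J"
    unfolding N_def q_def m_def
  proof (rule stepanov_bound[OF f])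
    have "real (2 * t) \<le> real q" "real t > 0"
      using t w wq by auto
    thus "0 < 2 * t" "2 * t \<le> CARD('a)"
      by (simp_all only: of_nat_le_iff q_def)
    show "2 * D + degree f \<le> CARD('a) + 1"
      using mq by (simp add: D_def flip: q_def m_def)
  qed (use h less in \<open>auto simp: q_def m_def\<close>)
  hence "real (2 * t * N) \<le> real (2 * t * m + D + (q div 2) * m + q * J)"
    by (simp only: of_nat_le_iff)
  hence "2 * real t * N \<le> 2 * t * m + D + real (q div 2) * m + real q * J"
    by simp
  also have "\<dots> \<le> 2 * t * m + q / 2 + q / 2 * m + real q * J"
    using D by (intro add_mono mult_right_mono) linarith+
  also have "\<dots> = real q * t + (2 * t * m + q / 2 * (5 * m + 5))"
    unfolding J_def by (simp add: algebra_simps)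
  also have "\<dots> \<le> real q * t + (2 * t * m + q / 2 * (10 * m))"
    using m by (intro add_mono mult_left_mono) auto
  also have "\<dots> = 2 * t * (q / 2) + m * (2 * t + 5 * (w * w))"
    by (simp add: algebra_simps w)
  \<comment> \<open>Division by \<open>2 * t\<close>, which exceeds \<open>w - 2\<close>, is
    prepared here: for \<open>w > 20\<close> the loss from rounding raises the constant only from 5
    to 6.\<close>
  also have "\<dots> \<le> 2 * t * (q / 2) + m * (2 * t * (6 * w))"
  proof (intro add_left_mono mult_left_mono)
    have "5 * w * w \<le> (w - 2) * (6 * w - 1)"
      using mult_strict_left_mono[OF w(3), of w] w by (simp add: algebra_simps)
    also have "\<dots> \<le> 2 * t * (6 * w - 1)"
      using t w by (intro mult_right_mono) auto
    finally show "2 * t + 5 * (w * w) \<le> 2 * t * (6 * w)"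
      by (simp add: algebra_simps)
  qed simp
  finally have "2 * real t * N \<le> 2 * real t * (q / 2 + 6 * m * w)"
    by (simp add: algebra_simps)
  moreover have "2 * real t > 0"
    using t w by linarith
  ultimately have "real N \<le> q / 2 + 6 * m * w"
    by (simp only: mult_le_cancel_left_pos)
  thus ?thesis
    by (simp add: N_def q_def m_def w_def)
qed

section \<open>Euler's criterion and the quadratic character\<close>

lemma one_neq_minus_one_if_odd_card:
  assumes "odd CARD('a)"
  shows "(1 :: 'a::finite_field) \<noteq> -1"
proof
  assume "(1 :: 'a) = -1"
  hence "of_nat 2 = (0 :: 'a)"
    by (metis add.right_inverse of_nat_1 of_nat_add one_add_one)
  hence "CHAR('a) dvd 2"
    by (simp only: of_nat_eq_0_iff_char_dvd)
  hence "CHAR('a) = 2"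
    using primes_dvd_imp_eq[of "CHAR('a)" 2] CHAR_prime[where 'a = 'a] by simp
  with CHAR_dvd_CARD[where 'a = 'a] assms show False
    by simp
qed

lemma power_half_card_cases:
  fixes x :: "'a::finite_field"
  assumes "odd CARD('a)" "x \<noteq> 0"
  shows "x ^ (CARD('a) div 2) = 1 \<or> x ^ (CARD('a) div 2) = -1"
proof -
  let ?h = "CARD('a) div 2"
  have "x ^ (2 * ?h + 1) = x"
    using finite_field_power_card_eq_same[of x] assms(1) by simp
  hence "(x ^ ?h) ^ 2 = 1"
    using assms(2) by (simp add: mult.commute flip: power_mult)
  thus ?thesis
    by (simp add: power2_eq_1_iff)
qed

text \<open>Euler's criterion by counting: nonzero squares are roots of X^h - 1, which has at most h
  = (q - 1) / 2 roots, and squaring is at most two-to-one on q - 1 elements, so there are at least h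
  squares.\<close>

lemma power_half_card_eq_1_iff:
  fixes x :: "'a::finite_field"
  assumes odd: "odd CARD('a)"
  shows "x ^ (CARD('a) div 2) = 1 \<longleftrightarrow> (\<exists>z. z \<noteq> 0 \<and> x = z\<^sup>2)"
proof -
  let ?q = "CARD('a)"
  let ?h = "?q div 2"
  have q: "2 * ?h + 1 = ?q"
    using odd by simp
  have "card {0, 1 :: 'a} \<le> ?q"
    by (intro card_mono) auto
  hence h: "?h > 0"
    by simp
  define S where "S = (\<lambda>z :: 'a. z\<^sup>2) ` (UNIV - {0})"
  have "S \<subseteq> {x. x ^ ?h = 1}"
  proof
    fix x assume "x \<in> S"
    then obtain z where z: "z \<noteq> 0" "x = z\<^sup>2"
      by (auto simp: S_def)
    have "z ^ (2 * ?h + 1) = z"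
      using finite_field_power_card_eq_same[of z] q by simp
    with z show "x \<in> {x. x ^ ?h = 1}"
      by (simp flip: power_mult)
  qed
  moreover have "card {x :: 'a. x ^ ?h = 1} \<le> card S"
  proof -
    define p :: "'a poly" where "p = monom 1 ?h - 1"
    have "coeff p 0 \<noteq> 0"
      using h by (simp add: p_def)
    hence "p \<noteq> 0"
      by auto
    have "{x :: 'a. x ^ ?h = 1} = {x. poly p x = 0}"
      by (simp add: p_def poly_monom)
    also have "card \<dots> \<le> degree p"
      by (rule card_poly_roots_bound) fact
    also have "degree p \<le> ?h"
      unfolding p_def by (intro degree_diff_le degree_monom_le) simp
    also have "?h \<le> card S"
    proof -
      have "?q - 1 = card (UNIV - {0 :: 'a})"
        by simp
      also have "\<dots> = (\<Sum>x\<in>S. card {z \<in> UNIV - {0}. z\<^sup>2 = x})"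
        unfolding S_def card_eq_sum by (rule sum.image_gen) simp
      also have "\<dots> \<le> (\<Sum>x\<in>S. 2)"
      proof (rule sum_mono)
        fix x assume "x \<in> S"
        then obtain z where z: "x = z\<^sup>2"
          by (auto simp: S_def)
        have "card {z \<in> UNIV - {0}. z\<^sup>2 = x} \<le> card {z, -z}"
          by (intro card_mono) (auto simp: z power2_eq_iff)
        also have "\<dots> \<le> 2"
          by (simp add: card_insert_if)
        finally show "card {z \<in> UNIV - {0}. z\<^sup>2 = x} \<le> 2" .
      qed
      finally show ?thesis
        using q by simp
    qed
    finally show ?thesis .
  qed
  ultimately have "S = {x. x ^ ?h = 1}"
    by (intro card_seteq) auto
  thus ?thesis
    by (auto simp: S_def)
qed

text \<open>The definition by the power (q - 1) / 2 makes multiplicativity immediate and matches the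
  level sets counted by Stepanov's method.\<close>

definition quadratic_char :: "'a::finite_field \<Rightarrow> real" where
  "quadratic_char x =
     (if x ^ (CARD('a) div 2) = 1 then 1 else if x ^ (CARD('a) div 2) = -1 then -1 else 0)"

lemma quadratic_char_mult:
  fixes x y :: "'a::finite_field"
  assumes "odd CARD('a)"
  shows "quadratic_char (x * y) = quadratic_char x * quadratic_char y"
proof -
  let ?h = "CARD('a) div 2"
  have "card {0, 1 :: 'a} \<le> CARD('a)"
    by (intro card_mono) auto
  hence "?h > 0"
    by simp
  hence 0: "quadratic_char (0 :: 'a) = 0"
    by (simp add: quadratic_char_def power_0_left)
  show ?thesis
  proof (cases "x = 0 \<or> y = 0")
    case False
    thus ?thesis
      using power_half_card_cases[OF assms, of x] power_half_card_cases[OF assms, of y]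
        one_neq_minus_one_if_odd_card[OF assms]
      by (auto simp: quadratic_char_def power_mult_distrib)
  qed (auto simp: 0)
qed

lemma quadratic_char_prod:
  fixes f :: "'b \<Rightarrow> 'a::finite_field"
  assumes "odd CARD('a)"
  shows "quadratic_char (\<Prod>x\<in>A. f x) = (\<Prod>x\<in>A. quadratic_char (f x))"
proof (induction A rule: infinite_finite_induct)
  case empty
  show ?case by (simp add: quadratic_char_def)
qed (simp_all add: quadratic_char_def[of 1] quadratic_char_mult[OF assms])

lemma abs_quadratic_char_le: "\<bar>quadratic_char x\<bar> \<le> 1"
  by (simp add: quadratic_char_def)

text \<open>The sum is the difference of the numbers of points with value 1 and -1. Together they
  miss only the roots of \<open>f\<close>, so the upper bound for either number gives a lower bound
  for the other. With m the degree, the difference is at most 12 m sqrt(q) + m.\<close>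

lemma abs_sum_quadratic_char_poly_le:
  fixes f :: "'a::finite_field poly"
  assumes f: "poly f 0 \<noteq> 0" "odd (order b f)" and q: "odd CARD('a)"
    and small: "20 * real (degree f) < sqrt CARD('a)"
  shows "\<bar>\<Sum>x\<in>UNIV. quadratic_char (poly f x)\<bar> \<le> 20 * degree f * sqrt CARD('a)"
proof -
  let ?h = "CARD('a) div 2"
  define N where "N = (\<lambda>c. {x. poly f x ^ ?h = c})"
  have "f \<noteq> 0"
    using f by auto
  have "(\<Sum>x\<in>UNIV. quadratic_char (poly f x)) =
        (\<Sum>x\<in>UNIV. (if x \<in> N 1 then 1 else 0) - (if x \<in> N (-1) then 1 else 0))"
    using one_neq_minus_one_if_odd_card[OF q] by (intro sum.cong) (auto simp: quadratic_char_def N_def)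
  also have "\<dots> = real (card (N 1)) - real (card (N (-1)))"
    by (simp add: sum_subtractf sum.If_cases)
  finally have sum: "(\<Sum>x\<in>UNIV. quadratic_char (poly f x)) = real (card (N 1)) - real (card (N (-1)))" .
  have "CARD('a) \<le> card (N 1 \<union> N (-1) \<union> {x. poly f x = 0})"
    using power_half_card_cases[OF q] by (intro card_mono) (auto simp: N_def)
  also have "\<dots> \<le> card (N 1) + card (N (-1)) + card {x. poly f x = 0}"
    by (intro order.trans[OF card_Un_le] add_mono card_Un_le) auto
  also have "\<dots> \<le> card (N 1) + card (N (-1)) + degree f"
    using card_poly_roots_bound[OF \<open>f \<noteq> 0\<close>] by simp
  finally have total: "real CARD('a) \<le> card (N 1) + card (N (-1)) + degree f"
    by (simp flip: of_nat_add)
  have upper: "real (card (N c)) \<le> real CARD('a) / 2 + 6 * real (degree f) * sqrt CARD('a)" for c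
    unfolding N_def by (rule card_poly_power_eq_le[OF f q small])
  have "real (degree f) * 1 \<le> real (degree f) * sqrt CARD('a)"
    by (intro mult_left_mono) (auto simp: Suc_leI)
  thus ?thesis
    using sum total upper[of 1] upper[of "-1"] unfolding abs_le_iff by (simp add: field_simps)
qed

text \<open>Translating by some \<open>c \<notin> B\<close> makes the polynomial nonzero at \<open>0\<close>.\<close>

lemma abs_sum_prod_quadratic_char_le:
  fixes B :: "'a::finite_field set"
  assumes q: "odd CARD('a)" and B: "B \<noteq> {}"
  shows "\<bar>\<Sum>x\<in>UNIV. \<Prod>y\<in>B. quadratic_char (y - x)\<bar> \<le> 20 * card B * sqrt CARD('a)"
proof (cases "20 * real (card B) < sqrt CARD('a)")
  case False
  \<comment> \<open>When \<open>B\<close> is this large, the trivial bound q = sqrt(q) * sqrt(q)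
    suffices.\<close>
  have "\<bar>\<Sum>x\<in>UNIV. \<Prod>y\<in>B. quadratic_char (y - x)\<bar> \<le> (\<Sum>x\<in>(UNIV :: 'a set). 1)"
    by (intro order.trans[OF sum_abs] sum_mono) (auto simp: abs_prod intro!: prod_le_1 abs_quadratic_char_le)
  also have "\<dots> = sqrt CARD('a) * sqrt CARD('a)"
    by simp
  also have "\<dots> \<le> 20 * real (card B) * sqrt CARD('a)"
    using False by (intro mult_right_mono) auto
  finally show ?thesis
    by simp
next
  case True
  have "card B < CARD('a)"
  proof -
    have "sqrt CARD('a) * 1 \<le> sqrt CARD('a) * sqrt CARD('a)"
      by (intro mult_left_mono) (auto simp: Suc_leI)
    hence "real (card B) < CARD('a)"
      using True by simp
    thus ?thesis by simp
  qed
  then obtain c where c: "c \<notin> B"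
    by (metis UNIV_I card_mono finite linorder_not_less subsetI)
  obtain b where b: "b \<in> B"
    using B by auto
  define f where "f = (\<Prod>y\<in>B. [:y - c, -1:])"
  have deg: "degree f = card B"
    unfolding f_def by (subst degree_prod_eq_sum_degree) auto
  have poly_f: "poly f x = (\<Prod>y\<in>B. y - (x + c))" for x
    by (simp add: f_def poly_prod algebra_simps)
  have "poly f 0 \<noteq> 0"
    using c by (auto simp: poly_f)
  \<comment> \<open>The linear factors have distinct roots, so each root is simple and in particular
    of odd order.\<close>
  moreover have "order (b - c) f = 1"
  proof -
    define g where "g = (\<Prod>y\<in>B - {b}. [:y - c, -1:])"
    have "f = [:b - c, -1:] * g"
      unfolding f_def g_def using b by (intro prod.remove) auto
    also have "[:b - c, -1:] = smult (-1) [:- (b - c), 1:]"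
      by simp
    finally have fg: "f = smult (-1) ([:- (b - c), 1:] * g)"
      by (simp only: mult_smult_left)
    have "poly g (b - c) \<noteq> 0"
      by (auto simp: g_def poly_prod)
    hence "order (b - c) g = 0" "g \<noteq> 0"
      by (auto intro: order_0I)
    moreover have "order (b - c) [:- (b - c), 1:] = 1"
      using order_power_n_n[of "b - c" 1] by simp
    ultimately show ?thesis
      unfolding fg by (simp add: order_smult order_mult del: mult_pCons_left)
  qed
  ultimately have "\<bar>\<Sum>x\<in>UNIV. quadratic_char (poly f x)\<bar> \<le> 20 * card B * sqrt CARD('a)"
    using abs_sum_quadratic_char_poly_le[of f "b - c"] q True by (simp add: deg)
  also have "(\<Sum>x\<in>UNIV. quadratic_char (poly f x)) = (\<Sum>x\<in>UNIV. \<Prod>y\<in>B. quadratic_char (y - (x + c)))"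
    by (simp add: poly_f quadratic_char_prod[OF q])
  also have "\<dots> = (\<Sum>x\<in>UNIV. \<Prod>y\<in>B. quadratic_char (y - x))"
    by (rule sum.reindex_bij_witness[of _ "\<lambda>x. x - c" "\<lambda>x. x + c"]) auto
  finally show ?thesis .
qed

text \<open>For \<open>x\<close> outside \<open>Y\<close>, the product \<open>G x\<close> is nonzero
  only if \<open>x\<close> induces the pattern \<open>A\<close>. It therefore suffices that the sum
  of \<open>G\<close> over all points exceeds its sum over \<open>Y\<close>.\<close>

lemma square_pattern_exists:
  fixes Y A :: "'a::finite_field set"
  assumes q: "odd CARD('a)" and A: "A \<subseteq> Y"
    and small: "2 ^ card Y * real (card Y) * (21 * sqrt CARD('a)) < CARD('a)"
  shows "\<exists>x. x \<notin> Y \<and> (\<forall>y\<in>Y. y \<in> A \<longleftrightarrow> (\<exists>z. z \<noteq> 0 \<and> y - x = z\<^sup>2))"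
proof -
  define n w where "n = card Y" and "w = sqrt CARD('a)"
  define \<epsilon> :: "'a \<Rightarrow> real" where "\<epsilon> = (\<lambda>y. if y \<in> A then 1 else -1)"
  define G where "G = (\<lambda>x. \<Prod>y\<in>Y. \<epsilon> y * quadratic_char (y - x) + 1)"
  define S where "S = (\<lambda>B. \<Sum>x\<in>UNIV. \<Prod>y\<in>B. quadratic_char (y - x :: 'a))"
  have "w \<ge> 1"
    by (simp add: w_def Suc_leI)
  have abs_\<epsilon>: "\<bar>\<Prod>y\<in>B. \<epsilon> y\<bar> = 1" for B
    by (simp add: abs_prod \<epsilon>_def if_distrib cong: if_cong)
  have "(\<Sum>x\<in>UNIV. G x) = (\<Sum>x\<in>UNIV. \<Sum>B\<in>Pow Y. (\<Prod>y\<in>B. \<epsilon> y) * (\<Prod>y\<in>B. quadratic_char (y - x)))"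
    by (simp add: G_def prod_add prod.distrib)
  also have "\<dots> = (\<Sum>B\<in>Pow Y. (\<Prod>y\<in>B. \<epsilon> y) * S B)"
    by (subst sum.swap) (simp add: S_def sum_distrib_left)
  also have "\<dots> = CARD('a) + (\<Sum>B\<in>Pow Y - {{}}. (\<Prod>y\<in>B. \<epsilon> y) * S B)"
    by (subst sum.remove[of _ "{}"]) (auto simp: S_def)
  finally have total: "(\<Sum>x\<in>UNIV. G x) = CARD('a) + (\<Sum>B\<in>Pow Y - {{}}. (\<Prod>y\<in>B. \<epsilon> y) * S B)" .
  have "\<bar>\<Sum>B\<in>Pow Y - {{}}. (\<Prod>y\<in>B. \<epsilon> y) * S B\<bar> \<le> (\<Sum>B\<in>Pow Y - {{}}. 20 * n * w)"
  proof (intro order.trans[OF sum_abs] sum_mono)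
    fix B assume B: "B \<in> Pow Y - {{}}"
    have "\<bar>(\<Prod>y\<in>B. \<epsilon> y) * S B\<bar> = \<bar>S B\<bar>"
      by (simp add: abs_mult abs_\<epsilon>)
    also have "\<dots> \<le> 20 * card B * w"
      unfolding S_def w_def using B by (intro abs_sum_prod_quadratic_char_le q) auto
    also have "\<dots> \<le> 20 * n * w"
      unfolding n_def using B \<open>w \<ge> 1\<close> by (intro mult_right_mono) (auto intro: card_mono)
    finally show "\<bar>(\<Prod>y\<in>B. \<epsilon> y) * S B\<bar> \<le> 20 * n * w" .
  qed
  also have "\<dots> = real (card (Pow Y - {{}})) * (20 * n * w)"
    by simp
  also have "\<dots> \<le> 2 ^ n * (20 * n * w)"
  proof (rule mult_right_mono)
    have "card (Pow Y - {{}}) \<le> card (Pow Y)"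
      by (intro card_mono) auto
    thus "real (card (Pow Y - {{}})) \<le> 2 ^ n"
      by (simp add: n_def card_Pow flip: of_nat_le_iff[where 'a = real])
  qed (use \<open>w \<ge> 1\<close> in auto)
  finally have error: "\<bar>\<Sum>B\<in>Pow Y - {{}}. (\<Prod>y\<in>B. \<epsilon> y) * S B\<bar> \<le> 2 ^ n * (20 * n * w)" .
  \<comment> \<open>The forbidden points in \<open>Y\<close> contribute at most
    \<open>2 ^ n * n\<close>; adding this to the error turns the constant 20 into the 21 of the
    hypothesis.\<close>
  have "(\<Sum>x\<in>Y. G x) \<le> (\<Sum>x\<in>Y. 2 ^ n)"
  proof (rule sum_mono)
    fix x
    have "G x \<le> (\<Prod>y\<in>Y. 2)"
      unfolding G_def
    proof (rule prod_mono)
      fix y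
      show "0 \<le> \<epsilon> y * quadratic_char (y - x) + 1 \<and> \<epsilon> y * quadratic_char (y - x) + 1 \<le> 2"
        by (auto simp: \<epsilon>_def quadratic_char_def)
    qed
    thus "G x \<le> 2 ^ n"
      by (simp add: n_def)
  qed
  also have "\<dots> = 2 ^ n * n"
    by (simp add: n_def)
  also have "\<dots> \<le> 2 ^ n * (n * w)"
    using \<open>w \<ge> 1\<close> by (simp add: mult_le_cancel_left1)
  finally have "(\<Sum>x\<in>Y. G x) < (\<Sum>x\<in>UNIV. G x)"
    using total error small by (simp add: n_def w_def algebra_simps)
  also have "(\<Sum>x\<in>UNIV. G x) = (\<Sum>x\<in>UNIV - Y. G x) + (\<Sum>x\<in>Y. G x)"
    by (rule sum.subset_diff) auto
  finally have "(\<Sum>x\<in>UNIV - Y. G x) \<noteq> 0"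
    by simp
  then obtain x where x: "x \<notin> Y" "G x \<noteq> 0"
    by (metis DiffD2 sum.neutral)
  show ?thesis
  proof (intro exI[of _ x] conjI ballI)
    fix y assume y: "y \<in> Y"
    \<comment> \<open>A nonzero factor rules out the character value \<open>- \<epsilon> y\<close>.
      Since \<open>y - x\<close> is nonzero, the value is then \<open>\<epsilon> y\<close>.\<close>
    have ne: "\<epsilon> y * quadratic_char (y - x) + 1 \<noteq> 0"
      using x(2) y by (auto simp: G_def)
    have "y - x \<noteq> 0"
      using x y by auto
    hence "(y - x) ^ (CARD('a) div 2) = 1 \<or> (y - x) ^ (CARD('a) div 2) = -1"
      by (rule power_half_card_cases[OF q])
    hence "y \<in> A \<longleftrightarrow> (y - x) ^ (CARD('a) div 2) = 1"
      using ne one_neq_minus_one_if_odd_card[OF q]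
      by (auto simp: \<epsilon>_def quadratic_char_def split: if_splits)
    thus "y \<in> A \<longleftrightarrow> (\<exists>z. z \<noteq> 0 \<and> y - x = z\<^sup>2)"
      by (simp add: power_half_card_eq_1_iff[OF q])
  qed fact
qed

section \<open>Transfer to fields given by records\<close>

lemma (in ring) mem_translate_nonzero_squares_iff:
  "y \<in> nonzero_squares R +> x \<longleftrightarrow> (\<exists>z\<in>carrier R. z \<noteq> \<zero> \<and> y = z \<otimes> z \<oplus> x)"
proof -
  have "z [^] (2 :: nat) = z \<otimes> z" if "z \<in> carrier R" for z
    using that by (simp add: numeral_2_eq_2)
  thus ?thesis
    unfolding nonzero_squares_def a_r_coset_def' by fastforce
qed

lemma shatters_nonzero_squares_ring_iso:
  assumes "ring K" "ring L" and \<phi>: "\<phi> \<in> ring_iso K L" and Y: "Y \<subseteq> carrier K"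
    and shatters: "shatters L (nonzero_squares L) (\<phi> ` Y)"
  shows "shatters K (nonzero_squares K) Y"
  unfolding shatters_def
proof (intro allI impI)
  interpret K: ring K by fact
  interpret L: ring L by fact
  have hom: "\<phi> \<in> ring_hom K L" and bij: "bij_betw \<phi> (carrier K) (carrier L)"
    using \<phi> by (auto simp: ring_iso_def)
  have inj: "inj_on \<phi> (carrier K)" and img: "\<phi> ` carrier K = carrier L"
    using bij by (auto simp: bij_betw_def)
  have zero: "\<phi> \<zero>\<^bsub>K\<^esub> = \<zero>\<^bsub>L\<^esub>"
    by (rule ring_hom_zero[OF hom]) fact+
  fix A assume A: "A \<subseteq> Y"
  then obtain x' where x': "x' \<in> carrier L" "x' \<notin> \<phi> ` Y"
      "\<forall>y\<in>\<phi> ` Y. y \<in> \<phi> ` A \<longleftrightarrow> y \<in> nonzero_squares L +>\<^bsub>L\<^esub> x'"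
    using shatters unfolding shatters_def by (metis image_mono)
  then obtain x where x: "x \<in> carrier K" "x' = \<phi> x"
    using img by blast
  show "\<exists>x\<in>carrier K. x \<notin> Y \<and> (\<forall>y\<in>Y. y \<in> A \<longleftrightarrow> y \<in> nonzero_squares K +>\<^bsub>K\<^esub> x)"
  proof (intro bexI[of _ x] conjI ballI)
    fix y assume y: "y \<in> Y"
    have y_in: "y \<in> carrier K"
      using y Y by auto
    have "y \<in> A \<longleftrightarrow> \<phi> y \<in> \<phi> ` A"
      using inj y Y A by (subst inj_on_image_mem_iff[of _ "carrier K"]) auto
    also have "\<dots> \<longleftrightarrow> \<phi> y \<in> nonzero_squares L +>\<^bsub>L\<^esub> \<phi> x"
      using x'(3) x(2) y by auto
    also have "\<dots> \<longleftrightarrow> (\<exists>z\<in>carrier K. \<phi> z \<noteq> \<zero>\<^bsub>L\<^esub> \<and> \<phi> y = \<phi> z \<otimes>\<^bsub>L\<^esub> \<phi> z \<oplus>\<^bsub>L\<^esub> \<phi> x)"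
      unfolding L.mem_translate_nonzero_squares_iff by (simp flip: img)
    also have "\<dots> \<longleftrightarrow> (\<exists>z\<in>carrier K. z \<noteq> \<zero>\<^bsub>K\<^esub> \<and> y = z \<otimes>\<^bsub>K\<^esub> z \<oplus>\<^bsub>K\<^esub> x)"
    proof (rule bex_cong[OF refl])
      fix z assume z: "z \<in> carrier K"
      have "\<phi> z = \<zero>\<^bsub>L\<^esub> \<longleftrightarrow> z = \<zero>\<^bsub>K\<^esub>"
        using inj_on_eq_iff[OF inj z K.zero_closed] zero by simp
      moreover have "\<phi> z \<otimes>\<^bsub>L\<^esub> \<phi> z \<oplus>\<^bsub>L\<^esub> \<phi> x = \<phi> (z \<otimes>\<^bsub>K\<^esub> z \<oplus>\<^bsub>K\<^esub> x)"
        using z x(1) by (simp add: ring_hom_add[OF hom] ring_hom_mult[OF hom])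
      moreover have "\<phi> y = \<phi> (z \<otimes>\<^bsub>K\<^esub> z \<oplus>\<^bsub>K\<^esub> x) \<longleftrightarrow> y = z \<otimes>\<^bsub>K\<^esub> z \<oplus>\<^bsub>K\<^esub> x"
        using z x(1) y_in by (intro inj_on_eq_iff[OF inj]) auto
      ultimately show "\<phi> z \<noteq> \<zero>\<^bsub>L\<^esub> \<and> \<phi> y = \<phi> z \<otimes>\<^bsub>L\<^esub> \<phi> z \<oplus>\<^bsub>L\<^esub> \<phi> x \<longleftrightarrow>
                       z \<noteq> \<zero>\<^bsub>K\<^esub> \<and> y = z \<otimes>\<^bsub>K\<^esub> z \<oplus>\<^bsub>K\<^esub> x"
        by simp
    qed
    also have "\<dots> \<longleftrightarrow> y \<in> nonzero_squares K +>\<^bsub>K\<^esub> x"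
      by (rule K.mem_translate_nonzero_squares_iff[symmetric])
    finally show "y \<in> A \<longleftrightarrow> y \<in> nonzero_squares K +>\<^bsub>K\<^esub> x" .
  qed (use x' x in auto)
qed

section \<open>Passing from a field given by a record to a type\<close>

hide_const (open) Polynomial.order

text \<open>The claim for a single field with an explicit size condition, free of limits, so that a
  counterexample is one field.\<close>

definition squares_shatter_small_sets :: "('a, 'm) ring_scheme \<Rightarrow> bool" where
  "squares_shatter_small_sets K \<longleftrightarrow>
     (\<forall>Y\<subseteq>carrier K. 2 ^ card Y * real (card Y) * (21 * sqrt (order K)) < order K \<longrightarrow>
        shatters K (nonzero_squares K) Y)"

definition odd_finite_field :: "('a, 'm) ring_scheme \<Rightarrow> bool" where
  "odd_finite_field K \<longleftrightarrow> field K \<and> finite (carrier K) \<and> odd (order K)"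

text \<open>Polynomials over type classes are only available for a fixed type, whereas \<open>K\<close> is a bound
  variable of the theorem. Since a type may depend on a constant, it suffices to choose a
  counterexample once and for all (any odd finite field if there is none) and to turn its carrier
  into a type.\<close>

definition test_field :: "int ring" where
  "test_field = (SOME K. odd_finite_field K \<and>
     ((\<exists>L :: int ring. odd_finite_field L \<and> \<not> squares_shatter_small_sets L) \<longrightarrow>
        \<not> squares_shatter_small_sets K))"

text \<open>Provides the candidate for \<open>test_field\<close> in case no counterexample
  exists.\<close>

lemma odd_finite_field_residue_ring_3: "odd_finite_field (residue_ring 3)"
proof -
  interpret residues_prime 3 "residue_ring 3"
    by unfold_locales simp_all
  have "carrier (residue_ring 3) = {0..2}"
    by (simp add: residue_ring_def)
  thus ?thesis
    using is_field by (simp add: odd_finite_field_def Coset.order_def)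
qed

text \<open>If any counterexample existed, \<open>test_field\<close> would be one; hence the
  property of \<open>test_field\<close> passes to every odd finite field over the integers.\<close>

lemma test_field:
  "odd_finite_field test_field"
  "odd_finite_field L \<Longrightarrow> squares_shatter_small_sets test_field \<Longrightarrow> squares_shatter_small_sets L"
  for L :: "int ring"
proof -
  have "\<exists>K :: int ring. odd_finite_field K \<and>
     ((\<exists>L :: int ring. odd_finite_field L \<and> \<not> squares_shatter_small_sets L) \<longrightarrow>
        \<not> squares_shatter_small_sets K)"
    using odd_finite_field_residue_ring_3 by blast
  from someI_ex[OF this, folded test_field_def]
  show "odd_finite_field test_field"
    "odd_finite_field L \<Longrightarrow> squares_shatter_small_sets test_field \<Longrightarrow> squares_shatter_small_sets L"
    by blast+
qed

interpretation test: field test_field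
  using test_field(1) by (simp add: odd_finite_field_def)

typedef test_elt = "carrier test_field"
  using test.zero_closed by blast

setup_lifting type_definition_test_elt

instantiation test_elt :: field
begin

lift_definition zero_test_elt :: test_elt is "\<zero>\<^bsub>test_field\<^esub>" by simp
lift_definition one_test_elt :: test_elt is "\<one>\<^bsub>test_field\<^esub>" by simp
lift_definition plus_test_elt :: "test_elt \<Rightarrow> test_elt \<Rightarrow> test_elt" is "\<lambda>x y. x \<oplus>\<^bsub>test_field\<^esub> y" by simp
lift_definition minus_test_elt :: "test_elt \<Rightarrow> test_elt \<Rightarrow> test_elt" is "\<lambda>x y. x \<ominus>\<^bsub>test_field\<^esub> y" by simp
lift_definition uminus_test_elt :: "test_elt \<Rightarrow> test_elt" is "\<lambda>x. \<ominus>\<^bsub>test_field\<^esub> x" by simp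
lift_definition times_test_elt :: "test_elt \<Rightarrow> test_elt \<Rightarrow> test_elt" is "\<lambda>x y. x \<otimes>\<^bsub>test_field\<^esub> y" by simp
text \<open>The type class requires the inverse of 0 to be 0, so this value is set
  explicitly.\<close>

lift_definition inverse_test_elt :: "test_elt \<Rightarrow> test_elt"
  is "\<lambda>x. if x = \<zero>\<^bsub>test_field\<^esub> then \<zero>\<^bsub>test_field\<^esub> else inv\<^bsub>test_field\<^esub> x"
  using test.field_Units by auto
definition divide_test_elt :: "test_elt \<Rightarrow> test_elt \<Rightarrow> test_elt" where
  "divide_test_elt x y = x * inverse y"

instance
proof
  fix a b c :: test_elt
  show "a * b * c = a * (b * c)" by transfer (rule test.m_assoc)
  show "a * b = b * a" by transfer (rule test.m_comm)
  show "1 * a = a" by transfer (rule test.l_one)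
  show "a + b + c = a + (b + c)" by transfer (rule test.a_assoc)
  show "a + b = b + a" by transfer (rule test.a_comm)
  show "0 + a = a" by transfer (rule test.l_zero)
  show "- a + a = 0" by transfer (rule test.l_neg)
  show "a - b = a + - b" by transfer (rule test.minus_eq)
  show "(a + b) * c = a * c + b * c" by transfer (rule test.l_distr)
  show "(0 :: test_elt) \<noteq> 1" by transfer (use test.one_not_zero in simp)
  show "inverse a * a = 1" if "a \<noteq> 0"
    using that by transfer (simp add: test.field_Units)
  show "a div b = a * inverse b" by (rule divide_test_elt_def)
  show "inverse (0 :: test_elt) = 0" by transfer simp
qed

end

instance test_elt :: finite_field
proof
  have "finite (carrier test_field)"
    using test_field(1) by (simp add: odd_finite_field_def)
  thus "finite (UNIV :: test_elt set)"
    using type_definition.Abs_image[OF type_definition_test_elt] by (metis finite_imageI)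
qed

lemma Rep_test_elt_mem_translate_iff:
  "Rep_test_elt y \<in> nonzero_squares test_field +>\<^bsub>test_field\<^esub> Rep_test_elt x \<longleftrightarrow>
     (\<exists>z. z \<noteq> 0 \<and> y - x = z\<^sup>2)"
proof -
  have "(\<exists>z. z \<noteq> 0 \<and> y - x = z\<^sup>2) \<longleftrightarrow> (\<exists>z. z \<noteq> 0 \<and> y = z * z + x)"
    by (simp add: diff_eq_eq power2_eq_square)
  also have "\<dots> \<longleftrightarrow> Rep_test_elt y \<in> nonzero_squares test_field +>\<^bsub>test_field\<^esub> Rep_test_elt x"
    unfolding test.mem_translate_nonzero_squares_iff by transfer auto
  finally show ?thesis by simp
qed

lemma squares_shatter_small_sets_test_field: "squares_shatter_small_sets test_field"
  unfolding squares_shatter_small_sets_def shatters_def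
proof (intro allI impI)
  interpret type_definition Rep_test_elt Abs_test_elt "carrier test_field"
    by (rule type_definition_test_elt)
  have card: "CARD(test_elt) = order test_field"
    by (simp add: Coset.order_def card)
  fix Y A
  assume Y: "Y \<subseteq> carrier test_field"
    and small: "2 ^ card Y * real (card Y) * (21 * sqrt (order test_field)) < order test_field"
    and A: "A \<subseteq> Y"
  have "card (Abs_test_elt ` Y) = card Y"
    by (intro card_image inj_onI) (use Y Abs_inject in blast)
  moreover have "Abs_test_elt ` A \<subseteq> Abs_test_elt ` Y"
    using A by (rule image_mono)
  ultimately obtain x where x: "x \<notin> Abs_test_elt ` Y"
      "\<forall>y\<in>Abs_test_elt ` Y. y \<in> Abs_test_elt ` A \<longleftrightarrow> (\<exists>z. z \<noteq> 0 \<and> y - x = z\<^sup>2)"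
    using square_pattern_exists[of "Abs_test_elt ` A" "Abs_test_elt ` Y"] small test_field(1)
    by (auto simp: card odd_finite_field_def)
  show "\<exists>x\<in>carrier test_field. x \<notin> Y \<and>
          (\<forall>y\<in>Y. y \<in> A \<longleftrightarrow> y \<in> nonzero_squares test_field +>\<^bsub>test_field\<^esub> x)"
  proof (intro bexI[of _ "Rep_test_elt x"] conjI ballI)
    show "Rep_test_elt x \<notin> Y"
      using x(1) Rep_inverse by (metis image_eqI)
    fix y assume y: "y \<in> Y"
    hence "y \<in> A \<longleftrightarrow> Abs_test_elt y \<in> Abs_test_elt ` A"
      using A Y Abs_inject by blast
    also have "\<dots> \<longleftrightarrow> Rep_test_elt (Abs_test_elt y) \<in> nonzero_squares test_field +>\<^bsub>test_field\<^esub> Rep_test_elt x"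
      using x(2) y unfolding Rep_test_elt_mem_translate_iff by blast
    also have "Rep_test_elt (Abs_test_elt y) = y"
      using y Y by (intro Abs_inverse) auto
    finally show "y \<in> A \<longleftrightarrow> y \<in> nonzero_squares test_field +>\<^bsub>test_field\<^esub> Rep_test_elt x" .
  qed (rule Rep)
qed

text \<open>A finite carrier embeds into the integers, and the image ring is an isomorphic field to
  which the choice of \<open>test_field\<close> applies.\<close>

lemma squares_shatter_small_sets_field:
  assumes "field K" and odd: "odd (order K)"
  shows "squares_shatter_small_sets K"
  unfolding squares_shatter_small_sets_def
proof (intro allI impI)
  interpret K: field K by fact
  \<comment> \<open>An infinite carrier would have order 0, which is even.\<close>
  have fin: "finite (carrier K)"
    using odd by (intro card_ge_0_finite) (auto simp: Coset.order_def intro: odd_pos)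
  then obtain g :: "'a \<Rightarrow> nat" where g: "inj_on g (carrier K)"
    using finite_imp_inj_to_nat_seg by metis
  define \<phi> where "\<phi> = int \<circ> g"
  have inj: "inj_on \<phi> (carrier K)"
    unfolding \<phi>_def using g by (intro comp_inj_on) auto
  define L where "L = image_ring \<phi> K"
  have iso: "\<phi> \<in> ring_iso K L"
    unfolding L_def by (rule inj_imp_image_ring_iso[OF inj])
  have "field L"
    unfolding L_def by (rule K.inj_imp_image_ring_is_field[OF inj])
  then interpret L: field L .
  have carrier_L: "carrier L = \<phi> ` carrier K"
    by (simp add: L_def image_ring_carrier)
  have order: "order L = order K"
    by (simp add: Coset.order_def carrier_L card_image[OF inj])
  have "odd_finite_field L"
    using fin odd order \<open>field L\<close> by (simp add: odd_finite_field_def carrier_L)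
  hence shatter_L: "squares_shatter_small_sets L"
    using test_field(2) squares_shatter_small_sets_test_field by blast
  fix Y
  assume Y: "Y \<subseteq> carrier K"
    and small: "2 ^ card Y * real (card Y) * (21 * sqrt (order K)) < order K"
  have "card (\<phi> ` Y) = card Y"
    using inj_on_subset[OF inj Y] by (rule card_image)
  hence "shatters L (nonzero_squares L) (\<phi> ` Y)"
    using shatter_L Y small unfolding squares_shatter_small_sets_def order carrier_L
    by (metis image_mono)
  thus "shatters K (nonzero_squares K) Y"
    by (intro shatters_nonzero_squares_ring_iso[OF _ _ iso Y] K.ring_axioms L.ring_axioms)
qed

section \<open>The size condition for large q and the limit inferior\<close>

lemma eventually_small_card:
  fixes \<epsilon> :: real
  assumes "\<epsilon> > 0"
  shows "eventually (\<lambda>q. \<forall>n. real n \<le> (1/2 - \<epsilon>) * log 2 (real q) \<longrightarrow>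
           2 ^ n * real n * (21 * sqrt (real q)) < real q) at_top"
proof -
  \<comment> \<open>Bounding \<open>2 ^ n\<close> by q^(1/2 - \<epsilon>) and \<open>n\<close> by
    half of log q, a factor q^(1 - \<epsilon>) splits off and exactly this comparison
    remains.\<close>
  have "eventually (\<lambda>q. 21/2 * log 2 (real q) < real q powr \<epsilon>) at_top"
    using assms by real_asymp
  with eventually_ge_at_top[of 2] show ?thesis
  proof eventually_elim
    case (elim q)
    have log: "log 2 q > 0"
      using elim by simp
    show ?case
    proof (intro allI impI)
      fix n assume n: "real n \<le> (1/2 - \<epsilon>) * log 2 q"
      have "2 ^ n = 2 powr n"
        by (simp add: powr_realpow)
      also have "\<dots> \<le> 2 powr ((1/2 - \<epsilon>) * log 2 q)"
        using n by simp
      also have "\<dots> = q powr (1/2 - \<epsilon>)"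
        using elim by (simp add: powr_def log_def)
      finally have pow: "2 ^ n \<le> q powr (1/2 - \<epsilon>)" .
      have "real n \<le> (1/2) * log 2 q"
        using n log assms by (intro order.trans[OF n] mult_right_mono) auto
      hence "2 ^ n * real n * (21 * sqrt q) \<le> q powr (1/2 - \<epsilon>) * (1/2 * log 2 q) * (21 * sqrt q)"
        using pow by (intro mult_right_mono[OF mult_mono]) auto
      also have "sqrt q = q powr (1/2)"
        by (simp add: powr_half_sqrt)
      also have "q powr (1/2 - \<epsilon>) * (1/2 * log 2 q) * (21 * q powr (1/2)) =
                 (q powr (1/2 - \<epsilon>) * q powr (1/2)) * (21/2 * log 2 q)"
        by simp
      also have "q powr (1/2 - \<epsilon>) * q powr (1/2) = q powr (1 - \<epsilon>)"
        by (simp flip: powr_add)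
      also have "q powr (1 - \<epsilon>) * (21/2 * log 2 q) < q powr (1 - \<epsilon>) * q powr \<epsilon>"
        using elim log by (intro mult_strict_left_mono) auto
      also have "\<dots> = q"
        using elim by (simp flip: powr_add)
      finally show "2 ^ n * real n * (21 * sqrt q) < q" 
        by (simp add: powr_half_sqrt)
    qed
  qed
qed

text \<open>The greatest number is meaningful only with an upper bound: the whole carrier is never
  shattered, because no point lies outside it.\<close>

lemma shattering_number_ge:
  assumes "finite (carrier K)"
    and "\<And>Y. Y \<subseteq> carrier K \<Longrightarrow> card Y \<le> m \<Longrightarrow> shatters K (nonzero_squares K) Y"
  shows "m \<le> shattering_number K"
  unfolding shattering_number_def
proof (rule Greatest_le_nat)
  fix k assume k: "\<forall>Y\<subseteq>carrier K. card Y \<le> k \<longrightarrow> shatters K (nonzero_squares K) Y"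
  have "\<not> shatters K (nonzero_squares K) (carrier K)"
    by (auto simp: shatters_def)
  thus "k \<le> card (carrier K)"
    using k by force
qed (use assms in blast)

theorem theorem1p3:
  shows "(\<forall>\<epsilon>::real. \<epsilon> > 0 \<longrightarrow>
            (\<exists>q0::nat. \<forall>q\<ge>q0. odd q \<and> primepow q \<longrightarrow>
               (\<forall>K :: 'a ring. field K \<and> order K = q \<longrightarrow>
                  (\<forall>Y\<subseteq>carrier K. real (card Y) \<le> (1/2 - \<epsilon>) * log 2 (real q) \<longrightarrow>
                     shatters K (nonzero_squares K) Y))))
       \<and> (\<forall>\<F> :: nat \<Rightarrow> 'a ring.
            (\<forall>q. odd q \<and> primepow q \<longrightarrow> field (\<F> q) \<and> order (\<F> q) = q) \<longrightarrow>
            ereal (1/2) \<le> Liminf (inf at_top (principal {q. odd q \<and> primepow q}))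
              (\<lambda>q. ereal (real (shattering_number (\<F> q)) / log 2 (real q))))"
    (is "?shatter \<and> ?liminf")
proof
  show shatter: ?shatter
  proof (intro allI impI)
    fix \<epsilon> :: real assume "\<epsilon> > 0"
    then obtain q0 where q0: "\<forall>q\<ge>q0. \<forall>n. real n \<le> (1/2 - \<epsilon>) * log 2 (real q) \<longrightarrow>
        2 ^ n * real n * (21 * sqrt (real q)) < real q"
      using eventually_small_card unfolding eventually_sequentially by blast
    have "shatters K (nonzero_squares K) Y"
      if "q \<ge> q0" "odd q" "field K" "order K = q" "Y \<subseteq> carrier K"
        "real (card Y) \<le> (1/2 - \<epsilon>) * log 2 (real q)" for q and K :: "'a ring" and Y
    proof -
      have "2 ^ card Y * real (card Y) * (21 * sqrt (order K)) < order K"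
        using that q0 by simp
      moreover have "squares_shatter_small_sets K"
        using that by (intro squares_shatter_small_sets_field) auto
      ultimately show ?thesis
        using that(5) by (simp add: squares_shatter_small_sets_def)
    qed
    thus "\<exists>q0. \<forall>q\<ge>q0. odd q \<and> primepow q \<longrightarrow>
               (\<forall>K :: 'a ring. field K \<and> order K = q \<longrightarrow>
                  (\<forall>Y\<subseteq>carrier K. real (card Y) \<le> (1/2 - \<epsilon>) * log 2 (real q) \<longrightarrow>
                     shatters K (nonzero_squares K) Y))"
      by blast
  qed
  show ?liminf
    unfolding le_Liminf_iff eventually_inf_principal
  proof (intro allI impI)
    fix \<F> :: "nat \<Rightarrow> 'a ring" and y
    assume \<F>: "\<forall>q. odd q \<and> primepow q \<longrightarrow> field (\<F> q) \<and> order (\<F> q) = q" and "y < ereal (1/2)"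
    then obtain r' where r': "y < ereal r'" "ereal r' < ereal (1/2)"
      using ereal_dense2 by blast
    \<comment> \<open>A nonnegative \<open>r\<close> keeps \<open>1/2 - \<epsilon>\<close>
      nonnegative, so that the floor below is not cut off by \<open>nat\<close>.\<close>
    define r where "r = max r' 0"
    have r: "y < ereal r" "0 \<le> r" "r < 1/2"
      using r' by (auto simp: r_def intro: less_le_trans)
    \<comment> \<open>The gap between \<open>r\<close> and 1/2 is split in two: one
      \<open>\<epsilon>\<close> is spent on the shattering bound, the other on rounding to an
      integer, once \<open>\<epsilon> * log 2 q\<close> is at least 1.\<close>
    define \<epsilon> where "\<epsilon> = (1/2 - r) / 2"
    have \<epsilon>: "\<epsilon> > 0" "r = 1/2 - 2 * \<epsilon>" "1/2 - \<epsilon> \<ge> 0"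
      using r by (auto simp: \<epsilon>_def field_simps)
    obtain q0 where q0: "\<forall>q\<ge>q0. odd q \<and> primepow q \<longrightarrow>
               (\<forall>K :: 'a ring. field K \<and> order K = q \<longrightarrow>
                  (\<forall>Y\<subseteq>carrier K. real (card Y) \<le> (1/2 - \<epsilon>) * log 2 (real q) \<longrightarrow>
                     shatters K (nonzero_squares K) Y))"
      using shatter \<epsilon>(1) by blast
    have "eventually (\<lambda>q. 1 \<le> \<epsilon> * log 2 (real q)) at_top"
      using \<epsilon>(1) by real_asymp
    with eventually_ge_at_top[of q0] eventually_ge_at_top[of 2]
    show "\<forall>\<^sub>F q in at_top. q \<in> {q. odd q \<and> primepow q} \<longrightarrow>
            y < ereal (real (shattering_number (\<F> q)) / log 2 (real q))"
    proof eventually_elim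
      case (elim q)
      show ?case
      proof
        assume q: "q \<in> {q. odd q \<and> primepow q}"
        have log: "log 2 q > 0"
          using elim by simp
        define m where "m = nat \<lfloor>(1/2 - \<epsilon>) * log 2 q\<rfloor>"
        have "(1/2 - \<epsilon>) * log 2 q \<ge> 0"
          using \<epsilon> log by simp
        hence m: "real m \<le> (1/2 - \<epsilon>) * log 2 q" "(1/2 - \<epsilon>) * log 2 q < real m + 1"
          unfolding m_def by linarith+
        have "m \<le> shattering_number (\<F> q)"
        proof (rule shattering_number_ge)
          show "finite (carrier (\<F> q))"
            using \<F> q elim by (intro card_ge_0_finite) (auto simp: Coset.order_def)
          show "shatters (\<F> q) (nonzero_squares (\<F> q)) Y"
            if "Y \<subseteq> carrier (\<F> q)" "card Y \<le> m" for Y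
          proof -
            have "real (card Y) \<le> (1/2 - \<epsilon>) * log 2 q"
              using that m(1) by linarith
            thus ?thesis
              using q0 elim \<F> q that(1) by blast
          qed
        qed
        hence "r * log 2 q \<le> real (shattering_number (\<F> q))"
          using m elim by (simp add: \<epsilon>(2) algebra_simps)
        hence "r \<le> real (shattering_number (\<F> q)) / log 2 q"
          using log by (simp add: pos_le_divide_eq)
        with r(1) show "y < ereal (real (shattering_number (\<F> q)) / log 2 q)"
          by (simp add: less_le_trans)
      qed
    qed
  qed
qed

end
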